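(* Let $f_n$ be the number of regular linearized chord diagrams of size $n$ and $g_n$ the number of connected regular linearized chord diagrams of size $n$. Then $$\frac{g_n}{f_n}=e^{-1}\bigl(1+O(n^{-1})\bigr)\qquad(n\to\infty).$$
   Context: A linearized chord diagram of size $n$ is a perfect matching of $\{1,2,\dots,2n\}$ into $n$ two-element sets called arcs. It is regular if it contains no pair of nested arcs $\{a,d\},\{b,c\}$ with $a<b<c<d$ such that either $b=a+1$ (the openers are adjacent) or $d=c+1$ (the closers are adjacent). Its intersection graph has the arcs as vertices, two arcs $\{a,b\},\{c,d\}$ ($a<b$, $c<d$) being adjacent if they cross, i.e. $a<c<b<d$ or $c<a<d<b$; the diagram is connected if this graph is connected. The number $f_n$ equals the $n$-th Fishburn number $[z^n]\sum_{k\ge0}\prod_{1\le j\le k}(1-(1-z)^j)$. *)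

theory Defs
  imports
    Complex_Main
    "HOL-Library.Landau_Symbols"
    "HOL-Library.Disjoint_Sets"
    "Graph_Theory.Graph_Theory"
begin

definition linearized_chord_diagram :: "nat \<Rightarrow> nat set set \<Rightarrow> bool" where
  "linearized_chord_diagram n D \<longleftrightarrow> partition_on {1..2 * n} D \<and> (\<forall>A\<in>D. card A = 2)"

definition regular_diagram :: "nat set set \<Rightarrow> bool" where
  "regular_diagram D \<longleftrightarrow> \<not> (\<exists>a b c d. a < b \<and> b < c \<and> c < d \<and> {a, d} \<in> D \<and> {b, c} \<in> D \<and>
     (b = a + 1 \<or> d = c + 1))"

definition crossing :: "nat set \<Rightarrow> nat set \<Rightarrow> bool" where
  "crossing A B \<longleftrightarrow> (\<exists>a b c d. A = {a, b} \<and> B = {c, d} \<and> a < b \<and> c < d \<and>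
     (a < c \<and> c < b \<and> b < d \<or> c < a \<and> a < d \<and> d < b))"

(* An undirected graph is represented as a digraph in which every edge occurs in both
   directions; crossing is symmetric and irreflexive, so this is a simple graph. *)
definition intersection_graph :: "nat set set \<Rightarrow> nat set pair_pre_digraph" where
  "intersection_graph D =
     \<lparr> pverts = D, parcs = {(A, B). A \<in> D \<and> B \<in> D \<and> crossing A B} \<rparr>"

(* The library's connected requires at least one vertex, so the empty diagram (n = 0) is
   not connected. *)
definition connected_diagram :: "nat set set \<Rightarrow> bool" where
  "connected_diagram D \<longleftrightarrow> Digraph_Component.connected (with_proj (intersection_graph D))"

(* card of an infinite set is 0; the sets counted below are finite. *)
lemma finite_linearized_chord_diagrams: "finite {D. linearized_chord_diagram n D}"
proof (rule finite_subset)
  show "{D. linearized_chord_diagram n D} \<subseteq> Pow (Pow {1..2 * n})"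
    by (auto simp: linearized_chord_diagram_def partition_on_def)
qed simp

definition num_regular :: "nat \<Rightarrow> nat" where
  "num_regular n = card {D. linearized_chord_diagram n D \<and> regular_diagram D}"

definition num_connected_regular :: "nat \<Rightarrow> nat" where
  "num_connected_regular n = card {D. linearized_chord_diagram n D \<and> regular_diagram D \<and> connected_diagram D}"

end

theory Submission
  imports Defs "HOL-Library.Multiset" "HOL-Library.Product_Lexorder" "HOL-Analysis.Convex"
begin

text \<open>
  Cut a regular diagram into its maximal runs of openers, each followed by a maximal run of closers,
  and count the arcs from the $i$-th opener run to the $j$-th closer run. This encodes regular
  diagrams of size $n$ bijectively as Fishburn matrices: upper triangular matrices over the naturals
  without zero rows or columns and with entry sum $n$. Write $k$ for the dimension of the matrix.

  A matrix of dimension $k$ has $k + 1$ children of size one more in the generating tree of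
  Bousquet-Melou, Claesson, Dukes and Kitaev, and there are also $k + 1$ gaps into which a short
  arc (an arc joining neighbouring points) can be inserted. Passing to a child almost always preserves
  the number of short arcs, so the numbers $N_r$ of matrices of size $n$ with $r$ short arcs satisfy
  $\sum_r |N_r - (r + 1) N_{r+1}| \le 8 f_{n-1}$; hence the number of short arcs is Poisson
  distributed with mean 1 up to an error $O(f_{n-1} / f_n)$. The tree also gives log-convexity of
  $f_n$ (by Cauchy-Schwarz) and $f_n / f_{n-1} \ge (n - 1) / 4$, so this error is $O(1/n)$.

  A connected diagram has no short arc. A disconnected diagram without short arcs arises by inserting
  a diagram of size $s$ into one of the gaps of a diagram of size $n - s$ with $2 \le s \le n - 2$,
  which accounts for at most $\sum_s f_s f_{n+1-s} = O(f_n / n)$ diagrams.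
\<close>

section \<open>Fishburn matrices and their generating tree\<close>

text \<open>The factor 1/e comes from blocks of size 1 alone. In the sum bounding the disconnected
  diagrams, s = 1 would contribute f_1 f_n, as much as f_n itself, so a union bound cannot treat it;
  this is why short arcs are counted separately and only blocks of size at least 2 are estimated.
  The separate count rests on a coincidence of index sets: matrices of size n with a marked short
  arc, and matrices of size n as such, are both encoded by pairs (M, t) with M of size n - 1 and t
  at most the dimension of M. So (r + 1) N_{r+1} counts the pairs whose M has r short arcs, and N_r
  those whose child has r. Exact agreement would force N_r = N_0 / r!. Growth comes from the same
  tree: f_{n+1} is the sum of k + 1 over the matrices of size n, and f_{n+2} is the sum of (k + 1)^2
  plus the number of children of larger dimension. Cauchy-Schwarz uses the squares only; the surplus
  makes the ratios grow linearly.\<close>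

text \<open>A matrix is the multiset of its positions, the multiplicity of a position being the entry there.\<close>

definition mdim :: "(nat \<times> nat) multiset \<Rightarrow> nat" where
  "mdim M = card (fst ` set_mset M)"

text \<open>The dimension is not stored but taken to be the number of nonzero rows. Equating the
  occupied rows and the occupied columns with \<open>{..<mdim M}\<close> then excludes zero rows and
  columns.\<close>

definition fishburn :: "(nat \<times> nat) multiset \<Rightarrow> bool" where
  "fishburn M \<longleftrightarrow> fst ` set_mset M = {..<mdim M} \<and> snd ` set_mset M = {..<mdim M} \<and>
     (\<forall>(i, j)\<in>#M. i \<le> j)"

definition fishburns :: "nat \<Rightarrow> (nat \<times> nat) multiset set" where
  "fishburns n = {M. fishburn M \<and> size M = n}"

lemma fishburnI:
  assumes "\<And>i j. (i, j) \<in># M \<Longrightarrow> i \<le> j \<and> j < k"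
    and "\<And>i. i < k \<Longrightarrow> \<exists>j. (i, j) \<in># M" and "\<And>j. j < k \<Longrightarrow> \<exists>i. (i, j) \<in># M"
  shows "fishburn M" "mdim M = k"
proof -
  have 1: "fst ` set_mset M = {..<k}" "snd ` set_mset M = {..<k}"
    using assms by (force simp: image_iff)+
  show 2: "mdim M = k" using 1 by (simp add: mdim_def)
  show "fishburn M" unfolding fishburn_def 2 using 1 assms by auto
qed

lemma fishburnD:
  assumes "fishburn M"
  shows "(i, j) \<in># M \<Longrightarrow> i \<le> j" "(i, j) \<in># M \<Longrightarrow> i < mdim M" "(i, j) \<in># M \<Longrightarrow> j < mdim M"
    and "i < mdim M \<Longrightarrow> \<exists>j. (i, j) \<in># M" and "j < mdim M \<Longrightarrow> \<exists>i. (i, j) \<in># M"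
proof -
  have 1: "fst ` set_mset M = {..<mdim M}" "snd ` set_mset M = {..<mdim M}"
    using assms unfolding fishburn_def by blast+
  show "(i, j) \<in># M \<Longrightarrow> i < mdim M" using 1 by force
  show "(i, j) \<in># M \<Longrightarrow> j < mdim M" using 1 by force
  show "i < mdim M \<Longrightarrow> \<exists>j. (i, j) \<in># M" using 1(1) by (metis fst_conv imageE lessThan_iff surj_pair)
  show "j < mdim M \<Longrightarrow> \<exists>i. (i, j) \<in># M" using 1(2) by (metis snd_conv imageE lessThan_iff surj_pair)
  show "(i, j) \<in># M \<Longrightarrow> i \<le> j" using assms unfolding fishburn_def by blast
qed

lemma mdim_eq_0_iff [simp]: "mdim M = 0 \<longleftrightarrow> M = {#}"
  by (simp add: mdim_def)

lemma mdim_empty [simp]: "mdim {#} = 0"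
  by simp

lemma mdim_le_size: "mdim M \<le> size M"
proof -
  have "mdim M \<le> card (set_mset M)" unfolding mdim_def by (rule card_image_le) simp
  also have "\<dots> \<le> size M" by (metis mset_set_set_mset_msubset size_mset_mono size_mset_set)
  finally show ?thesis .
qed

lemma fishburns_0: "fishburns 0 = {{#}}"
  by (auto simp: fishburns_def fishburn_def mdim_def)

section \<open>Children, parents and labels in the generating tree\<close>

definition top_row :: "(nat \<times> nat) multiset \<Rightarrow> nat" where
  "top_row M = Min {i. (i, mdim M - 1) \<in># M}"

text \<open>Renumbering that makes room for a new index t; \<open>unskip\<close> closes the room
  again, and its value at t itself is a dummy.\<close>

definition skip :: "nat \<Rightarrow> nat \<Rightarrow> nat" where
  "skip t i = (if i < t then i else Suc i)"

definition unskip :: "nat \<Rightarrow> nat \<Rightarrow> nat" where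
  "unskip t i = (if i < t then i else i - 1)"

definition split_at :: "nat \<Rightarrow> nat \<Rightarrow> nat \<times> nat \<Rightarrow> nat \<times> nat" where
  "split_at t k = (\<lambda>(i, j). (skip t i, if j = k - 1 \<and> i < t then t else skip t j))"

definition merge_at :: "nat \<Rightarrow> nat \<Rightarrow> nat \<times> nat \<Rightarrow> nat \<times> nat" where
  "merge_at t k = (\<lambda>(i, j). (unskip t i, if j = t then k - 1 else unskip t j))"

text \<open>
  The three cases of \<open>child\<close> are those of Dukes and Parviainen: append a diagonal entry 1, increase an
  entry of the last column, or insert a new row and column at \<open>t\<close>. In the last case the part of the last
  column above row \<open>t\<close> moves into the new column and the only entry of the new row is a 1 in the
  last column. In each case \<open>t\<close> becomes the top row of the last column, so that it can be recovered.
\<close>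

definition child :: "(nat \<times> nat) multiset \<Rightarrow> nat \<Rightarrow> (nat \<times> nat) multiset" where
  "child M t =
     (let k = mdim M in
      if t = k then add_mset (k, k) M
      else if t \<le> top_row M then add_mset (t, k - 1) M
      else add_mset (t, k) (image_mset (split_at t k) M))"

text \<open>The case is read off after deleting the top entry \<open>(t, k)\<close> of the last
  column once. If row t stays occupied, an entry was increased; if t = k, the corner was appended or
  increased. In both cases deletion suffices, since \<open>mdim\<close> adapts by itself. An emptied
  row t < k can only be an inserted one, and column t is merged back into the last column.\<close>

definition parent :: "(nat \<times> nat) multiset \<Rightarrow> (nat \<times> nat) multiset" where
  "parent C =
     (let k = mdim C - 1; t = top_row C; M = C - {#(t, k)#} in
      if t \<in> fst ` set_mset M \<or> t = k then M else image_mset (merge_at t k) M)"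

lemma finite_col: "finite {i. (i, c) \<in># M}"
  by (rule finite_subset[of _ "fst ` set_mset M"]) force+

lemma top_row_eqI:
  assumes "mdim C = Suc k" "(t, k) \<in># C" "\<And>i. (i, k) \<in># C \<Longrightarrow> t \<le> i"
  shows "top_row C = t"
  unfolding top_row_def assms(1) using assms by (intro Min_eqI finite_col) auto

lemma top_row:
  assumes "fishburn M" "M \<noteq> {#}"
  shows "(top_row M, mdim M - 1) \<in># M" "(i, mdim M - 1) \<in># M \<Longrightarrow> top_row M \<le> i"
    "top_row M < mdim M" "(mdim M - 1, mdim M - 1) \<in># M"
proof -
  have k: "mdim M > 0" using assms(2) by (metis mdim_eq_0_iff gr0I)
  obtain j where j: "(mdim M - 1, j) \<in># M" using fishburnD(4)[OF assms(1), of "mdim M - 1"] k by auto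
  then have "j = mdim M - 1" using fishburnD(1,3)[OF assms(1) j] by simp
  with j show 1: "(mdim M - 1, mdim M - 1) \<in># M" by simp
  have "top_row M \<in> {i. (i, mdim M - 1) \<in># M}"
    unfolding top_row_def using 1 by (intro Min_in finite_col) blast
  then show 2: "(top_row M, mdim M - 1) \<in># M" by simp
  show "(i, mdim M - 1) \<in># M \<Longrightarrow> top_row M \<le> i"
    unfolding top_row_def by (intro Min_le finite_col) simp
  show "top_row M < mdim M" using fishburnD(2)[OF assms(1) 2] .
qed

lemma skip_simps: "skip t i \<noteq> t" "unskip t (skip t i) = i" "i \<noteq> t \<Longrightarrow> skip t (unskip t i) = i"
    "skip t i \<le> skip t j \<longleftrightarrow> i \<le> j" "skip t i = skip t j \<longleftrightarrow> i = j"
  by (auto simp: skip_def unskip_def split: if_splits)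

lemma merge_at_split_at: "snd p < k \<Longrightarrow> merge_at t k (split_at t k p) = p"
  by (auto simp: merge_at_def split_at_def skip_simps split: prod.splits)

lemma size_child [simp]: "size (child M t) = Suc (size M)"
  by (simp add: child_def Let_def)

lemma child_props:
  assumes "fishburn M" "t \<le> mdim M"
  shows "fishburn (child M t)"
    "mdim (child M t) = (if t < mdim M \<and> t \<le> top_row M then mdim M else Suc (mdim M))"
    "top_row (child M t) = t"
proof -
  define k where "k = mdim M"
  note F = fishburnD[OF assms(1), folded k_def]
  consider (a) "t = k" | (b) "t < k" "t \<le> top_row M" | (c) "t < k" "top_row M < t"
    using assms(2) k_def by linarith
  then have "fishburn (child M t) \<and> mdim (child M t) = (if t < mdim M \<and> t \<le> top_row M then mdim M else Suc (mdim M)) \<and> top_row (child M t) = t"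
  proof cases
    case a
    then have C: "child M t = add_mset (k, k) M" by (simp add: child_def k_def Let_def)
    have 1: "fishburn (child M t)" and 2: "mdim (child M t) = Suc k"
      unfolding C using F by (intro fishburnI[of _ "Suc k"]; force simp: less_Suc_eq)+
    have "top_row (child M t) = t"
      by (rule top_row_eqI[OF 2]; unfold C) (auto simp: a dest: F)
    with 1 2 a show ?thesis by (simp add: k_def)
  next
    case b
    then have C: "child M t = add_mset (t, k - 1) M" by (simp add: child_def k_def Let_def)
    have "M \<noteq> {#}" using b k_def by auto
    note T = top_row[OF assms(1) this, folded k_def]
    have 1: "fishburn (child M t)" and 2: "mdim (child M t) = k"
      unfolding C using F b by (intro fishburnI[of _ k]; force)+
    then have 3: "mdim (child M t) = Suc (k - 1)" using b by simp
    have "top_row (child M t) = t"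
      by (rule top_row_eqI[OF 3]) (use T(2) b(2) in \<open>force simp: C\<close>)+
    with 1 2 b show ?thesis by (simp add: k_def)
  next
    case c
    then have C: "child M t = add_mset (t, k) (image_mset (split_at t k) M)" by (simp add: child_def k_def Let_def)
    have "M \<noteq> {#}" using c k_def by auto
    note T = top_row[OF assms(1) this, folded k_def]
    have mem: "(i, j) \<in># child M t \<longleftrightarrow> (i = t \<and> j = k) \<or>
        (\<exists>i' j'. (i', j') \<in># M \<and> i = skip t i' \<and> j = (if j' = k - 1 \<and> i' < t then t else skip t j'))" for i j
      unfolding C split_at_def by force
    have row: "\<exists>j. (i, j) \<in># child M t" if "i < Suc k" for i
    proof (cases "i = t")
      case True then show ?thesis unfolding mem by blast
    next
      case False
      then have "unskip t i < k" using that c by (auto simp: unskip_def)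
      then obtain j where "(unskip t i, j) \<in># M" using F(4) by blast
      then show ?thesis unfolding mem using skip_simps(3)[OF False] by metis
    qed
    have col: "\<exists>i. (i, j) \<in># child M t" if jk: "j < Suc k" for j
    proof -
      consider "j = t" | "j = k" | "j \<noteq> t" "j < k" using jk by linarith
      then show ?thesis
      proof cases
        \<comment> \<open>Column t is not empty: the top entry of the old last column lies above row
          t and moves there.\<close>
        case 1 then show ?thesis unfolding mem using T(1) c by metis
      next
        case 2 then show ?thesis unfolding mem by blast
      next
        case 3
        then have "unskip t j < k" "unskip t j \<noteq> k - 1" using c by (auto simp: unskip_def)
        then show ?thesis unfolding mem using F(5)[of "unskip t j"] skip_simps(3)[OF 3(1)] by metis
      qed
    qed
    have bd: "i \<le> j \<and> j < Suc k" if "(i, j) \<in># child M t" for i j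
      using that c unfolding mem by (auto dest: F(1,3) simp: skip_def split: if_splits)
    have 1: "fishburn (child M t)" and 2: "mdim (child M t) = Suc k"
      using fishburnI[of "child M t", OF bd row col] by auto
    have "top_row (child M t) = t"
    proof (rule top_row_eqI[OF 2])
      show "(t, k) \<in># child M t" unfolding mem by blast
      fix i assume "(i, k) \<in># child M t"
      then show "t \<le> i" unfolding mem using c by (auto dest: F(3) simp: skip_def split: if_splits)
    qed
    with 1 2 c show ?thesis by (simp add: k_def)
  qed
  then show "fishburn (child M t)"
    "mdim (child M t) = (if t < mdim M \<and> t \<le> top_row M then mdim M else Suc (mdim M))"
    "top_row (child M t) = t" by auto
qed

lemma parent_child:
  assumes "fishburn M" "t \<le> mdim M"
  shows "parent (child M t) = M"
proof -
  define k where "k = mdim M"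
  note F = fishburnD[OF assms(1), folded k_def]
  note P = child_props[OF assms, folded k_def]
  consider (a) "t = k" | (b) "t < k" "t \<le> top_row M" | (c) "t < k" "top_row M < t"
    using assms(2) k_def by linarith
  then show ?thesis
  proof cases
    case a
    then have "child M t = add_mset (k, k) M" by (simp add: child_def k_def Let_def)
    then show ?thesis using P a by (simp add: parent_def Let_def)
  next
    case b
    then have "child M t = add_mset (t, k - 1) M" by (simp add: child_def k_def Let_def)
    moreover have "t \<in> fst ` set_mset M" using F(4)[OF b(1)] by force
    ultimately show ?thesis using P b by (simp add: parent_def Let_def)
  next
    case c
    then have C: "child M t = add_mset (t, k) (image_mset (split_at t k) M)" by (simp add: child_def k_def Let_def)
    have "t \<notin> fst ` split_at t k ` set_mset M" by (auto simp: split_at_def skip_simps(1)[symmetric])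
    moreover have "image_mset (\<lambda>x. merge_at t k (split_at t k x)) M = image_mset (\<lambda>x. x) M"
      by (rule image_mset_cong) (auto intro!: merge_at_split_at dest: F(3))
    ultimately show ?thesis
      using P c C by (auto simp: parent_def Let_def multiset.map_comp comp_def)
  qed
qed

lemma child_parent:
  assumes "fishburn C" "C \<noteq> {#}"
  shows "fishburn (parent C)" "top_row C \<le> mdim (parent C)" "child (parent C) (top_row C) = C"
proof -
  define k where "k = mdim C - 1"
  define t where "t = top_row C"
  define M where "M = C - {#(t, k)#}"
  have dC: "mdim C = Suc k" using assms(2) unfolding k_def by (metis mdim_eq_0_iff Suc_pred' gr0I)
  note F = fishburnD[OF assms(1), unfolded dC]
  note T = top_row[OF assms, unfolded dC diff_Suc_1, folded t_def]
  have CM: "C = add_mset (t, k) M" unfolding M_def using T(1) by simp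
  have P: "parent C = (if t \<in> fst ` set_mset M \<or> t = k then M else image_mset (merge_at t k) M)"
    by (simp add: parent_def Let_def dC t_def M_def)
  have "fishburn (parent C) \<and> t \<le> mdim (parent C) \<and> child (parent C) t = C"
  proof (cases "t \<in> fst ` set_mset M")
    case True
    then have P: "parent C = M" using P by simp
    obtain j where j: "(t, j) \<in># M" using True by force
    \<comment> \<open>The corner survives the deletion: for t = k the second entry of row k is
      forced onto the diagonal.\<close>
    have kM: "(k, k) \<in># M"
    proof (cases "t = k")
      case True
      have "j = k" using j F(1)[of t j] F(3)[of t j] True by (simp add: CM)
      then show ?thesis using j True by simp
    next
      case False
      then show ?thesis using T(4) by (simp add: CM)
    qed
    have row: "\<exists>j. (i, j) \<in># M" if "i < Suc k" for i using F(4)[OF that] j by (auto simp: CM)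
    have col: "\<exists>i. (i, j) \<in># M" if "j < Suc k" for j using F(5)[OF that] kM by (auto simp: CM)
    have bd: "i \<le> j \<and> j < Suc k" if "(i, j) \<in># M" for i j using that F(1,3) by (auto simp: CM)
    have f: "fishburn M" and d: "mdim M = Suc k" using fishburnI[OF bd row col] by auto
    have "M \<noteq> {#}" using kM by auto
    then have "t \<le> top_row M" using top_row(1)[OF f] T(2) d by (auto simp: CM)
    then have "child M t = C" using T(3) by (simp add: child_def d CM Let_def)
    then show ?thesis using P f d T(3) by simp
  next
    case False
    then have notin: "(t, j) \<notin># M" for j by force
    show ?thesis
    proof (cases "t = k")
      case True
      then have P: "parent C = M" using P by simp
      have bd: "i \<le> j \<and> j < k" if "(i, j) \<in># M" for i j
      proof -
        have "(i, j) \<in># C" using that by (simp add: CM)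
        then show ?thesis using F(1,3)[of i j] T(2)[of i] notin[of j] that True
          by (metis le_antisym le_neq_implies_less less_Suc_eq_le)
      qed
      have row: "\<exists>j. (i, j) \<in># M" if "i < k" for i using F(4)[of i] that True by (auto simp: CM)
      have col: "\<exists>i. (i, j) \<in># M" if "j < k" for j using F(5)[of j] that by (auto simp: CM)
      have f: "fishburn M" and d: "mdim M = k" using fishburnI[OF bd row col] by auto
      show ?thesis using P f d True by (simp add: child_def CM Let_def)
    next
      case neq: False
      then have tk: "t < k" using T(3) by simp
      define N where "N = image_mset (merge_at t k) M"
      have P: "parent C = N" using P False neq by (simp add: N_def)
      have inM: "i \<le> j" "j \<le> k" "i \<noteq> t" "j = k \<Longrightarrow> t < i" if "(i, j) \<in># M" for i j
        using that F(1,3)[of i j] T(2)[of i] notin by (auto simp: CM intro!: le_neq_implies_less)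
      have mem: "(i, j) \<in># N \<longleftrightarrow>
        (\<exists>i' j'. (i', j') \<in># M \<and> i = unskip t i' \<and> j = (if j' = t then k - 1 else unskip t j'))" for i j
        unfolding N_def merge_at_def by force
      have bd: "i \<le> j \<and> j < k" if "(i, j) \<in># N" for i j
        using that tk inM(1-3) unfolding mem by (fastforce simp: unskip_def split: if_splits)
      have row: "\<exists>j. (i, j) \<in># N" if "i < k" for i
      proof -
        have "skip t i < Suc k" using that by (simp add: skip_def)
        then obtain j where "(skip t i, j) \<in># C" using F(4) by blast
        then have "(skip t i, j) \<in># M" by (simp add: CM skip_simps)
        then show ?thesis unfolding mem using skip_simps(2) by metis
      qed
      have col: "\<exists>i. (i, j) \<in># N" if "j < k" for j
      proof (cases "j = k - 1")
        case True
        have "(k, k) \<in># M" using T(4) neq by (simp add: CM)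
        then show ?thesis unfolding mem unskip_def using True tk by (metis less_not_refl2 not_less_iff_gr_or_eq)
      next
        case False
        then have "skip t j < k" using that by (auto simp: skip_def)
        then obtain i where "(i, skip t j) \<in># C" using F(5)[of "skip t j"] by auto
        then have "(i, skip t j) \<in># M" using \<open>skip t j < k\<close> by (simp add: CM)
        then show ?thesis unfolding mem using skip_simps(1,2) by metis
      qed
      have f: "fishburn N" and d: "mdim N = k" using fishburnI[OF bd row col] by auto
      \<comment> \<open>Row t of C has its only entry in column k > t, so column t needs an entry
        strictly above row t. Merged into the last column of N, it forces
        \<open>top_row N < t\<close>, the third case of \<open>child\<close>.\<close>
      have "(t, t) \<notin># C" using notin tk by (simp add: CM)
      then obtain i0 where i0: "(i0, t) \<in># M" using F(5)[of t] tk by (auto simp: CM)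
      then have "i0 < t" using inM[of i0 t] by simp
      then have "(i0, k - 1) \<in># N" unfolding mem using i0 by (metis unskip_def)
      then have "top_row N < t" using top_row(2)[OF f, of i0] \<open>i0 < t\<close> d tk by force
      moreover have "image_mset (split_at t k) N = M"
      proof -
        have "image_mset (\<lambda>x. split_at t k (merge_at t k x)) M = image_mset (\<lambda>x. x) M"
        proof (rule image_mset_cong)
          fix x assume x: "x \<in># M"
          obtain i j where ij: "x = (i, j)" by (cases x)
          note I = inM[OF x[unfolded ij]]
          show "split_at t k (merge_at t k x) = x"
            using I tk by (auto simp: ij split_at_def merge_at_def skip_def unskip_def) linarith
        qed
        then show ?thesis by (simp add: N_def multiset.map_comp comp_def)
      qed
      ultimately have "child N t = C" using tk by (simp add: child_def d CM Let_def)
      then show ?thesis using P f d tk by simp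
    qed
  qed
  then show "fishburn (parent C)" "top_row C \<le> mdim (parent C)" "child (parent C) (top_row C) = C"
    by (auto simp: t_def)
qed

lemma bij_betw_child:
  "bij_betw (\<lambda>(M, t). child M t) (SIGMA M:fishburns n. {..mdim M}) (fishburns (Suc n))"
proof (rule bij_betw_byWitness[where f' = "\<lambda>C. (parent C, top_row C)"])
  show "\<forall>a\<in>SIGMA M:fishburns n. {..mdim M}. (parent (case a of (M, t) \<Rightarrow> child M t), top_row (case a of (M, t) \<Rightarrow> child M t)) = a"
    by (auto simp: fishburns_def parent_child child_props)
  have ne: "C \<noteq> {#}" if "C \<in> fishburns (Suc n)" for C using that by (auto simp: fishburns_def)
  show "\<forall>C\<in>fishburns (Suc n). (case (parent C, top_row C) of (M, t) \<Rightarrow> child M t) = C"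
    using child_parent ne by (auto simp: fishburns_def)
  show "(\<lambda>(M, t). child M t) ` (SIGMA M:fishburns n. {..mdim M}) \<subseteq> fishburns (Suc n)"
    by (auto simp: fishburns_def child_props)
  show "(\<lambda>C. (parent C, top_row C)) ` fishburns (Suc n) \<subseteq> (SIGMA M:fishburns n. {..mdim M})"
  proof (rule image_subsetI)
    fix C assume C: "C \<in> fishburns (Suc n)"
    then have c: "fishburn C" "size C = Suc n" by (auto simp: fishburns_def)
    have "Suc (size (parent C)) = Suc n"
      using child_parent(3)[OF c(1) ne[OF C]] c(2) by (metis size_child)
    then show "(parent C, top_row C) \<in> (SIGMA M:fishburns n. {..mdim M})"
      using child_parent(1,2)[OF c(1) ne[OF C]] by (simp add: fishburns_def)
  qed
qed

lemma finite_fishburns: "finite (fishburns n)"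
proof (induction n)
  case 0 then show ?case by (simp add: fishburns_0)
next
  case (Suc n)
  then have "finite (SIGMA M:fishburns n. {..mdim M})" by blast
  then show ?case using bij_betw_finite[OF bij_betw_child] by blast
qed

text \<open>One level of the tree as a summation rule: constant h gives the recursion for the
  cardinalities, \<open>mdim M + 1\<close> a two-level recursion, and indicators of the number of
  short indices the distribution of short arcs.\<close>

lemma sum_fishburns_Suc:
  fixes h :: "(nat \<times> nat) multiset \<Rightarrow> 'b::comm_monoid_add"
  shows "sum h (fishburns (Suc n)) = (\<Sum>M\<in>fishburns n. \<Sum>t\<le>mdim M. h (child M t))"
  using sum.reindex_bij_betw[OF bij_betw_child, of h n]
  by (simp add: sum.Sigma finite_fishburns case_prod_beta')

section \<open>Growth of the Fishburn numbers\<close>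

lemma card_fishburns_Suc: "card (fishburns (Suc n)) = (\<Sum>M\<in>fishburns n. Suc (mdim M))"
  using sum_fishburns_Suc[of "\<lambda>_. 1::nat" n] by simp

lemma card_fishburns_le_Suc: "card (fishburns n) \<le> card (fishburns (Suc n))"
  unfolding card_fishburns_Suc card_eq_sum[of "fishburns n"] by (rule sum_mono) simp

lemma card_fishburns_pos: "card (fishburns n) > 0"
proof (induction n)
  case (Suc n)
  then show ?case using card_fishburns_le_Suc[of n] by linarith
qed (simp add: fishburns_0)

lemma sum_indicator_above:
  assumes "s < k"
  shows "(\<Sum>t\<le>k. if t < k \<and> t \<le> s then 0 else 1 :: real) = real (k - s)"
proof -
  have "(\<Sum>t\<le>k. if t < k \<and> t \<le> s then 0 else 1 :: real) = (\<Sum>t\<in>{s<..k}. 1)"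
    by (rule sum.mono_neutral_cong_right) (use assms in auto)
  then show ?thesis by simp
qed

text \<open>For n \<ge> 1 this is the number of pairs of a matrix and a label whose child has larger
  dimension, namely the labels t with \<open>top_row M < t \<le> mdim M\<close>. As
  \<open>top_row\<close> is the last label used, these are the ascents in the sequence of labels, as
  in ascent sequences.\<close>

definition ascents :: "nat \<Rightarrow> real" where
  "ascents n = (\<Sum>M\<in>fishburns n. real (mdim M - top_row M))"

lemma fishburns_pos:
  assumes "M \<in> fishburns (Suc n)"
  shows "fishburn M" "M \<noteq> {#}" "top_row M < mdim M" "mdim M > 0"
proof -
  show "fishburn M" "M \<noteq> {#}" using assms by (auto simp: fishburns_def)
  then show "top_row M < mdim M" using top_row(3) by blast
  then show "mdim M > 0" by simp
qed

text \<open>The recursion is applied twice: each of the k + 1 children contributes k + 1, and one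
  more if its dimension has grown, which happens for k - \<open>top_row M\<close> labels.\<close>

lemma card_fishburns_Suc_Suc:
  "real (card (fishburns (n + 3))) = (\<Sum>M\<in>fishburns (Suc n). (real (mdim M) + 1)\<^sup>2) + ascents (Suc n)"
proof -
  have "real (card (fishburns (n + 3))) = (\<Sum>M\<in>fishburns (Suc (Suc n)). real (mdim M) + 1)"
    using card_fishburns_Suc[of "Suc (Suc n)"] by (simp add: eval_nat_numeral add.commute)
  also have "\<dots> = (\<Sum>M\<in>fishburns (Suc n). \<Sum>t\<le>mdim M. real (mdim (child M t)) + 1)"
    by (rule sum_fishburns_Suc)
  also have "\<dots> = (\<Sum>M\<in>fishburns (Suc n). (real (mdim M) + 1)\<^sup>2 + real (mdim M - top_row M))"
  proof (rule sum.cong[OF refl])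
    fix M assume M: "M \<in> fishburns (Suc n)"
    note P = fishburns_pos[OF M]
    have "(\<Sum>t\<le>mdim M. real (mdim (child M t)) + 1) =
        (\<Sum>t\<le>mdim M. (real (mdim M) + 1) + (if t < mdim M \<and> t \<le> top_row M then 0 else 1))"
      by (rule sum.cong) (auto simp: child_props[OF P(1)])
    also have "\<dots> = (real (mdim M) + 1)\<^sup>2 + real (mdim M - top_row M)"
      unfolding sum.distrib sum_indicator_above[OF P(3)] by (simp add: power2_eq_square algebra_simps)
    finally show "(\<Sum>t\<le>mdim M. real (mdim (child M t)) + 1) = (real (mdim M) + 1)\<^sup>2 + real (mdim M - top_row M)" .
  qed
  finally show ?thesis by (simp add: sum.distrib ascents_def)
qed

text \<open>The child with label t has top row t, so it contributes k - t, plus 1 if t exceeds the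
  old top row. The sum over t is k (k + 1) / 2 + (k - \<open>top_row M\<close>), while the share of
  M in f_{n+3} is (k + 1)^2 + (k - \<open>top_row M\<close>). From k + 1 \<le> 2 k comes the factor
  1/4.\<close>

lemma ascents_ge: "ascents (Suc (Suc n)) \<ge> real (card (fishburns (n + 3))) / 4"
proof -
  have "ascents (Suc (Suc n)) = (\<Sum>M\<in>fishburns (Suc n). \<Sum>t\<le>mdim M. real (mdim (child M t) - top_row (child M t)))"
    unfolding ascents_def by (rule sum_fishburns_Suc)
  also have "\<dots> \<ge> (\<Sum>M\<in>fishburns (Suc n). ((real (mdim M) + 1)\<^sup>2 + real (mdim M - top_row M)) / 4)"
  proof (rule sum_mono)
    fix M assume M: "M \<in> fishburns (Suc n)"
    note P = fishburns_pos[OF M]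
    define k where "k = mdim M"
    have gauss: "(\<Sum>t\<le>k. real t) = real k * (real k + 1) / 2"
      by (induction k) (auto simp: field_simps)
    have "(\<Sum>t\<le>k. real (mdim (child M t) - top_row (child M t))) =
        (\<Sum>t\<le>k. (real k - real t) + (if t < k \<and> t \<le> top_row M then 0 else 1))"
      by (rule sum.cong) (auto simp: child_props[OF P(1)] k_def of_nat_diff)
    also have "\<dots> = real k * (real k + 1) / 2 + real (k - top_row M)"
      unfolding sum.distrib sum_indicator_above[OF P(3), folded k_def] sum_subtractf gauss
      by (simp add: field_simps)
    also have "\<dots> \<ge> ((real k + 1)\<^sup>2 + real (k - top_row M)) / 4"
    proof -
      have "1 * (real k + 1) \<le> real k * (real k + 1)" using P(4) k_def by (intro mult_right_mono) auto
      then show ?thesis by (simp add: power2_eq_square field_simps)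
    qed
    finally show "(\<Sum>t\<le>mdim M. real (mdim (child M t) - top_row (child M t))) \<ge>
        ((real (mdim M) + 1)\<^sup>2 + real (mdim M - top_row M)) / 4" by (simp add: k_def)
  qed
  also have "(\<Sum>M\<in>fishburns (Suc n). ((real (mdim M) + 1)\<^sup>2 + real (mdim M - top_row M)) / 4) =
      real (card (fishburns (n + 3))) / 4"
    unfolding card_fishburns_Suc_Suc ascents_def by (simp add: sum_divide_distrib sum.distrib add_divide_distrib)
  finally show ?thesis .
qed

text \<open>Cauchy-Schwarz for the weights k + 1 needs only the sum of their squares. What this
  leaves over of f_{n+3} is kept, because plain log-convexity would not make the ratios
  grow.\<close>

lemma card_fishburns_log_convex_strong:
  "(real (card (fishburns (Suc (Suc n)))))\<^sup>2 + real (card (fishburns (Suc n))) * ascents (Suc n)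
    \<le> real (card (fishburns (n + 3))) * real (card (fishburns (Suc n)))"
proof -
  have "(real (card (fishburns (Suc (Suc n)))))\<^sup>2 = (\<Sum>M\<in>fishburns (Suc n). real (mdim M) + 1)\<^sup>2"
    by (simp add: card_fishburns_Suc add.commute)
  also have "\<dots> \<le> (\<Sum>M\<in>fishburns (Suc n). (real (mdim M) + 1)\<^sup>2) * real (card (fishburns (Suc n)))"
    by (rule sum_squared_le_sum_of_squares)
  finally show ?thesis unfolding card_fishburns_Suc_Suc by (simp add: algebra_simps)
qed

definition growth :: "nat \<Rightarrow> real" where
  "growth n = real (card (fishburns (Suc n))) / real (card (fishburns n))"

lemma growth_ge_1: "growth n \<ge> 1"
  using card_fishburns_le_Suc[of n] card_fishburns_pos[of n] by (simp add: growth_def)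

text \<open>After division by the product of the two smaller cardinalities the surplus becomes an
  increment of the ratio, and \<open>ascents_ge\<close> makes this increment at least 1/4.\<close>

lemma growth_Suc:
  "growth (Suc (Suc n)) \<ge> growth (Suc n)" "growth (n + 3) \<ge> growth (Suc (Suc n)) + 1 / 4"
proof -
  have *: "growth (Suc (Suc m)) \<ge> growth (Suc m) + ascents (Suc m) / real (card (fishburns (Suc (Suc m))))" for m
  proof -
    define a b c where "a = real (card (fishburns (Suc m)))" and "b = real (card (fishburns (Suc (Suc m))))"
      and "c = real (card (fishburns (m + 3)))"
    have "a > 0" "b > 0" using card_fishburns_pos by (auto simp: a_def b_def)
    moreover have "b\<^sup>2 + a * ascents (Suc m) \<le> c * a"
      using card_fishburns_log_convex_strong[of m] by (simp add: a_def b_def c_def)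
    ultimately have "(b * b + a * ascents (Suc m)) / (a * b) \<le> (c * a) / (a * b)"
      by (intro divide_right_mono) (auto simp: power2_eq_square)
    with \<open>a > 0\<close> \<open>b > 0\<close> have "b / a + ascents (Suc m) / b \<le> c / b"
      by (simp add: add_divide_distrib)
    then show ?thesis by (simp add: growth_def a_def b_def c_def eval_nat_numeral)
  qed
  have "ascents (Suc n) \<ge> 0" by (simp add: ascents_def sum_nonneg)
  then have "ascents (Suc n) / real (card (fishburns (Suc (Suc n)))) \<ge> 0" by simp
  then show "growth (Suc (Suc n)) \<ge> growth (Suc n)" using *[of n] by linarith
  have "ascents (Suc (Suc n)) / real (card (fishburns (n + 3))) \<ge> 1 / 4"
    using ascents_ge[of n] card_fishburns_pos[of "n + 3"] by (simp add: field_simps)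
  then show "growth (n + 3) \<ge> growth (Suc (Suc n)) + 1 / 4"
    using *[of "Suc n"] unfolding numeral_3_eq_3 add_Suc_right add_0_right by linarith
qed

lemma growth_mono:
  assumes "1 \<le> i" "i \<le> j"
  shows "growth i \<le> growth j"
  using assms(2)
proof (induction rule: dec_induct)
  case (step m)
  then show ?case using growth_Suc(1)[of "m - 1"] assms(1) by (cases m) auto
qed simp

lemma growth_ge: "growth n \<ge> real n / 4"
proof (cases "n \<ge> 2")
  case True
  then show ?thesis
  proof (induction n rule: dec_induct)
    case base
    show ?case using growth_ge_1[of 2] by simp
  next
    case (step m)
    obtain l where l: "m = Suc (Suc l)" using step(1) by (metis le_Suc_ex add_2_eq_Suc)
    show ?case using growth_Suc(2)[of l] step(3) by (simp add: l eval_nat_numeral field_simps)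
  qed
next
  case False
  then have "real n / 4 \<le> 1" by simp
  then show ?thesis using growth_ge_1[of n] by linarith
qed

lemma card_fishburns_Suc_ge: "real (card (fishburns n)) * real n / 4 \<le> real (card (fishburns (Suc n)))"
  using growth_ge[of n] card_fishburns_pos[of n] by (simp add: growth_def field_simps)

lemma card_fishburns_exchange:
  assumes "1 \<le> a" "a \<le> b"
  shows "card (fishburns (Suc a)) * card (fishburns b) \<le> card (fishburns a) * card (fishburns (Suc b))"
proof -
  have "real (card (fishburns (Suc a)) * card (fishburns b)) \<le> real (card (fishburns a) * card (fishburns (Suc b)))"
    using growth_mono[OF assms] card_fishburns_pos[of a] card_fishburns_pos[of b]
    by (simp add: growth_def field_simps)
  then show ?thesis by linarith
qed

text \<open>Log-convexity: with a fixed sum of indices the product grows as the indices move apart,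
  one use of \<open>card_fishburns_exchange\<close> per step.\<close>

lemma card_fishburns_mult_le:
  assumes "1 \<le> a" "a \<le> s" "s \<le> t"
  shows "card (fishburns s) * card (fishburns t) \<le> card (fishburns a) * card (fishburns (s + t - a))"
  using assms(2,3)
proof (induction s arbitrary: t rule: dec_induct)
  case (step m)
  have "card (fishburns (Suc m)) * card (fishburns t) \<le> card (fishburns m) * card (fishburns (Suc t))"
    using step assms(1) by (intro card_fishburns_exchange) auto
  also have "\<dots> \<le> card (fishburns a) * card (fishburns (m + Suc t - a))"
    using step by (intro step.IH) auto
  finally show ?case by simp
qed simp

lemma card_fishburns_pred:
  assumes "n \<ge> 2"
  shows "real (card (fishburns (n - 1))) \<le> 8 * real (card (fishburns n)) / real n"
proof -
  \<comment> \<open>Since n - 1 \<ge> n / 2, the factor (n - 1) / 4 is at least n / 8.\<close>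
  have "real (card (fishburns (n - 1))) * (real n / 8) \<le> real (card (fishburns (n - 1))) * (real (n - 1) / 4)"
    using assms by (intro mult_left_mono) (auto simp: of_nat_diff)
  also have "\<dots> \<le> real (card (fishburns n))" using card_fishburns_Suc_ge[of "n - 1"] assms by simp
  finally show ?thesis using assms by (simp add: field_simps)
qed

text \<open>Only the term s = 2 has an index as large as n - 1, and it is of order f_n / n. In all
  others both indices are at least 3, so log-convexity bounds each by f_3 f_{n-2} = O(f_n / n^2),
  and there are fewer than n of them.\<close>

lemma card_fishburns_convolution:
  obtains C :: real where "C > 0"
    "\<And>n. n \<ge> 4 \<Longrightarrow> real (\<Sum>s=2..n-2. card (fishburns s) * card (fishburns (n + 1 - s))) \<le> C * real (card (fishburns n)) / real n"
proof -
  define f where "f = (\<lambda>n. real (card (fishburns n)))"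
  have fpos: "f n > 0" for n using card_fishburns_pos by (simp add: f_def)
  have "real (\<Sum>s=2..n-2. card (fishburns s) * card (fishburns (n + 1 - s))) \<le> (8 * f 2 + 128 * f 3) * f n / real n" if n: "n \<ge> 4" for n
  proof -
    have p1: "f (n - 1) \<le> 8 * f n / real n" using card_fishburns_pred[of n] n by (simp add: f_def)
    have "f (n - 2) \<le> 8 * f (n - 1) / real (n - 1)"
      using card_fishburns_pred[of "n - 1"] n by (simp add: f_def numeral_2_eq_2)
    also have "\<dots> \<le> 8 * f (n - 1) / (real n / 2)"
      using n fpos[of "n - 1"] by (intro divide_left_mono mult_pos_pos) (auto simp: of_nat_diff)
    also have "\<dots> \<le> 8 * (8 * f n / real n) / (real n / 2)"
      using n p1 by (intro divide_right_mono mult_left_mono) auto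
    \<comment> \<open>128 = 8 * 8 * 2, where the 2 pays for replacing n - 1 by n / 2.\<close>
    finally have p2: "f (n - 2) \<le> 128 * f n / real n / real n" using n by (simp add: field_simps)
    have trm: "f s * f (n + 1 - s) \<le> f 3 * f (n - 2)" if "3 \<le> s" "s \<le> n - 2" for s
    proof -
      have *: "f a * f b \<le> f 3 * f (n - 2)" if "3 \<le> a" "a \<le> b" "a + b = n + 1" for a b
      proof -
        have "n - 2 = a + b - 3" using that n by simp
        then show ?thesis using card_fishburns_mult_le[of 3 a b] that unfolding f_def
          by (metis (mono_tags, lifting) of_nat_le_iff of_nat_mult one_le_numeral)
      qed
      show ?thesis
      proof (cases "s \<le> n + 1 - s")
        case True then show ?thesis using *[of s "n + 1 - s"] that n by simp
      next
        case False then show ?thesis using *[of "n + 1 - s" s] that n by (simp add: mult.commute)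
      qed
    qed
    have "real (\<Sum>s=2..n-2. card (fishburns s) * card (fishburns (n + 1 - s))) = (\<Sum>s=2..n-2. f s * f (n + 1 - s))"
      by (simp add: f_def)
    also have "\<dots> = f 2 * f (n - 1) + (\<Sum>s=3..n-2. f s * f (n + 1 - s))"
      using n by (subst sum.atLeast_Suc_atMost) (auto simp: eval_nat_numeral)
    also have "\<dots> \<le> f 2 * f (n - 1) + (\<Sum>s=3..n-2. f 3 * f (n - 2))"
      using trm by (intro add_left_mono sum_mono) auto
    also have "\<dots> \<le> f 2 * f (n - 1) + real n * (f 3 * f (n - 2))"
      using fpos[of 3] fpos[of "n - 2"] by (auto intro!: mult_right_mono)
    also have "\<dots> \<le> f 2 * (8 * f n / real n) + real n * (f 3 * (128 * f n / real n / real n))"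
      using p1 p2 fpos[of 2] fpos[of 3] by (intro add_mono mult_left_mono) auto
    also have "\<dots> = (8 * f 2 + 128 * f 3) * f n / real n" using n by (simp add: field_simps)
    finally show ?thesis .
  qed
  moreover have "8 * f 2 + 128 * f 3 > 0" using fpos[of 2] fpos[of 3] by simp
  ultimately show ?thesis using that unfolding f_def by blast
qed

section \<open>Short arcs\<close>

definition touching :: "nat \<Rightarrow> nat \<times> nat \<Rightarrow> bool" where
  "touching i p \<longleftrightarrow> fst p = i \<or> snd p = i"

text \<open>In the diagram, such an index is an arc joining two neighbouring points.\<close>

definition shorts :: "(nat \<times> nat) multiset \<Rightarrow> nat set" where
  "shorts M = {i. filter_mset (touching i) M = {#(i, i)#}}"

lemma shortsD:
  assumes "i \<in> shorts M"
  shows "(i, i) \<in># M" "(i, j) \<in># M \<Longrightarrow> j = i" "(j, i) \<in># M \<Longrightarrow> j = i"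
proof -
  have eq: "filter_mset (touching i) M = {#(i, i)#}" using assms by (simp add: shorts_def)
  then have *: "p \<in># M \<and> touching i p \<longleftrightarrow> p = (i, i)" for p
    by (metis (mono_tags, lifting) filter_mset_eq_conv set_mset_filter mem_Collect_eq singletonD set_mset_single singletonI)
  show "(i, i) \<in># M" using *[of "(i, i)"] by simp
  show "(i, j) \<in># M \<Longrightarrow> j = i" using *[of "(i, j)"] by (simp add: touching_def)
  show "(j, i) \<in># M \<Longrightarrow> j = i" using *[of "(j, i)"] by (simp add: touching_def)
qed

lemma shorts_subset: "fishburn M \<Longrightarrow> shorts M \<subseteq> {..<mdim M}"
  using shortsD(1) fishburnD(2) by blast

lemma finite_shorts [simp]: "finite (shorts M)"
proof (rule finite_subset)
  show "shorts M \<subseteq> fst ` set_mset M" using shortsD(1) by force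
qed simp

lemma card_shorts_le: "fishburn M \<Longrightarrow> card (shorts M) \<le> size M"
  using card_mono[OF _ shorts_subset[of M]] mdim_le_size[of M] by simp

lemma shorts_add_mset:
  assumes "\<not> touching i p"
  shows "i \<in> shorts (add_mset p M) \<longleftrightarrow> i \<in> shorts M"
  using assms by (simp add: shorts_def)

lemma not_shorts_add_mset:
  assumes "touching i p" "q \<in># M" "touching i q"
  shows "i \<notin> shorts (add_mset p M)"
proof
  assume "i \<in> shorts (add_mset p M)"
  then have "filter_mset (touching i) M = {#}" using assms(1) by (simp add: shorts_def)
  then show False using assms(2,3) by (simp add: filter_mset_eq_conv)
qed

lemma image_mset_eq_single: "image_mset f A = {#y#} \<longleftrightarrow> (\<exists>x. A = {#x#} \<and> f x = y)"
  by (cases A) auto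

text \<open>Stated for a map f on positions rather than for a renumbering of rows and columns,
  because \<open>split_at\<close> treats the two coordinates jointly.\<close>

lemma shorts_image_mset:
  assumes "\<And>p. p \<in># M \<Longrightarrow> touching (\<tau> i) (f p) \<longleftrightarrow> touching i p"
    and "\<And>p. p \<in># M \<Longrightarrow> f p = (\<tau> i, \<tau> i) \<longleftrightarrow> p = (i, i)"
  shows "\<tau> i \<in> shorts (image_mset f M) \<longleftrightarrow> i \<in> shorts M"
proof -
  have "filter_mset (touching (\<tau> i)) (image_mset f M) = image_mset f (filter_mset (\<lambda>p. touching (\<tau> i) (f p)) M)"
    by (simp add: filter_mset_image_mset)
  also have "\<dots> = image_mset f (filter_mset (touching i) M)"
    using assms(1) by (metis (mono_tags, lifting) filter_mset_cong)
  finally have "\<tau> i \<in> shorts (image_mset f M) \<longleftrightarrow> (\<exists>p. filter_mset (touching i) M = {#p#} \<and> f p = (\<tau> i, \<tau> i))"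
    by (simp add: shorts_def image_mset_eq_single)
  also have "\<dots> \<longleftrightarrow> i \<in> shorts M"
  proof
    assume "\<exists>p. filter_mset (touching i) M = {#p#} \<and> f p = (\<tau> i, \<tau> i)"
    then obtain p where p: "filter_mset (touching i) M = {#p#}" "f p = (\<tau> i, \<tau> i)" by blast
    then have "p \<in># filter_mset (touching i) M" by simp
    then have "p \<in># M" by simp
    then show "i \<in> shorts M" using p assms(2) by (simp add: shorts_def)
  next
    assume i: "i \<in> shorts M"
    then show "\<exists>p. filter_mset (touching i) M = {#p#} \<and> f p = (\<tau> i, \<tau> i)"
      using assms(2) shortsD(1)[OF i] by (auto simp: shorts_def)
  qed
  finally show ?thesis .
qed

lemma inj_skip: "inj (skip t)"
  by (rule injI) (simp add: skip_simps)

definition ins_short :: "nat \<Rightarrow> (nat \<times> nat) multiset \<Rightarrow> (nat \<times> nat) multiset" where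
  "ins_short g M = add_mset (g, g) (image_mset (map_prod (skip g) (skip g)) M)"

definition del_short :: "nat \<Rightarrow> (nat \<times> nat) multiset \<Rightarrow> (nat \<times> nat) multiset" where
  "del_short g M = image_mset (map_prod (unskip g) (unskip g)) (M - {#(g, g)#})"

lemma shorts_ins_short: "shorts (ins_short g M) = insert g (skip g ` shorts M)"
proof -
  have g: "g \<in> shorts (ins_short g M)"
  proof -
    have "filter_mset (touching g) (image_mset (map_prod (skip g) (skip g)) M) = {#}"
      by (auto simp: filter_mset_eq_conv touching_def skip_simps)
    then show ?thesis by (simp add: shorts_def ins_short_def touching_def)
  qed
  have "i \<in> shorts (ins_short g M) \<longleftrightarrow> i \<in> skip g ` shorts M" if "i \<noteq> g" for i
  proof -
    have i: "i = skip g (unskip g i)" using skip_simps(3)[OF that] by simp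
    have "i \<in> shorts (ins_short g M) \<longleftrightarrow> skip g (unskip g i) \<in> shorts (image_mset (map_prod (skip g) (skip g)) M)"
      using that i unfolding ins_short_def by (subst shorts_add_mset) (auto simp: touching_def)
    also have "\<dots> \<longleftrightarrow> unskip g i \<in> shorts M"
      by (rule shorts_image_mset) (auto simp: touching_def skip_simps)
    also have "\<dots> \<longleftrightarrow> i \<in> skip g ` shorts M"
      using i inj_image_mem_iff[OF inj_skip] by metis
    finally show ?thesis .
  qed
  with g show ?thesis by (intro set_eqI) (metis insert_iff)
qed

lemma card_shorts_ins_short: "card (shorts (ins_short g M)) = Suc (card (shorts M))"
proof -
  have "g \<notin> skip g ` shorts M" by (metis imageE skip_simps(1))
  then show ?thesis unfolding shorts_ins_short
    by (simp add: card_image[OF inj_on_subset[OF inj_skip]])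
qed

text \<open>The domain is that of \<open>bij_betw_child\<close>: gaps for a short arc and labels for
  a child range over the same set. The Poisson law rests on this.\<close>

lemma bij_betw_ins_short:
  "bij_betw (\<lambda>(M, g). (ins_short g M, g)) (SIGMA M:fishburns n. {..mdim M}) (SIGMA C:fishburns (Suc n). shorts C)"
proof (rule bij_betw_byWitness[where f' = "\<lambda>(C, g). (del_short g C, g)"])
  have "del_short g (ins_short g M) = M" for g M
    by (simp add: del_short_def ins_short_def multiset.map_comp comp_def map_prod_def skip_simps case_prod_beta')
  then show "\<forall>a\<in>SIGMA M:fishburns n. {..mdim M}. (\<lambda>(C, g). (del_short g C, g)) ((\<lambda>(M, g). (ins_short g M, g)) a) = a"
    by auto
  show "(\<lambda>(M, g). (ins_short g M, g)) ` (SIGMA M:fishburns n. {..mdim M}) \<subseteq> (SIGMA C:fishburns (Suc n). shorts C)"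
  proof (rule image_subsetI)
    fix x assume "x \<in> (SIGMA M:fishburns n. {..mdim M})"
    then obtain M g where x: "x = (M, g)" and M: "M \<in> fishburns n" and g: "g \<le> mdim M" by auto
    then have f: "fishburn M" and sz: "size M = n" by (auto simp: fishburns_def)
    define C where "C = ins_short g M"
    have mem: "(i, j) \<in># C \<longleftrightarrow> (i = g \<and> j = g) \<or> (\<exists>i' j'. (i', j') \<in># M \<and> i = skip g i' \<and> j = skip g j')" for i j
      unfolding C_def ins_short_def by force
    have us: "unskip g i < mdim M" if "i < Suc (mdim M)" "i \<noteq> g" for i
      using that g by (auto simp: unskip_def)
    have "fishburn C"
    proof (rule fishburnI[of C "Suc (mdim M)"])
      show "i \<le> j \<and> j < Suc (mdim M)" if "(i, j) \<in># C" for i j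
        using that g unfolding mem by (auto simp: skip_simps skip_def dest: fishburnD(1,3)[OF f])
      show "\<exists>j. (i, j) \<in># C" if "i < Suc (mdim M)" for i
        unfolding mem using fishburnD(4)[OF f us[OF that]] skip_simps(3)[of i g] by metis
      show "\<exists>i. (i, j) \<in># C" if "j < Suc (mdim M)" for j
        unfolding mem using fishburnD(5)[OF f us[OF that]] skip_simps(3)[of j g] by metis
    qed
    then show "(case x of (M, g) \<Rightarrow> (ins_short g M, g)) \<in> (SIGMA C:fishburns (Suc n). shorts C)"
      using sz by (simp add: x fishburns_def shorts_ins_short C_def) (simp add: ins_short_def)
  qed
  have *: "ins_short g (del_short g C) = C \<and> del_short g C \<in> fishburns n \<and> g \<le> mdim (del_short g C)"
    if C: "C \<in> fishburns (Suc n)" and g: "g \<in> shorts C" for C g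
  proof -
    from C have f: "fishburn C" and sz: "size C = Suc n" by (auto simp: fishburns_def)
    define N where "N = C - {#(g, g)#}"
    have CN: "C = add_mset (g, g) N" using shortsD(1)[OF g] by (simp add: N_def)
    have "filter_mset (touching g) N = {#}"
      using g by (simp add: CN shorts_def touching_def)
    then have "\<not> touching g p" if "p \<in># N" for p
      using that by (metis (mono_tags, lifting) empty_iff mem_Collect_eq set_mset_empty set_mset_filter)
    then have ne: "i \<noteq> g \<and> j \<noteq> g" if "(i, j) \<in># N" for i j
      using that by (force simp: touching_def)
    define k where "k = mdim C - 1"
    have "g < mdim C" using g shorts_subset[OF f] by blast
    then have k: "mdim C = Suc k" and gk: "g \<le> k" by (auto simp: k_def)
    have D: "del_short g C = image_mset (map_prod (unskip g) (unskip g)) N" by (simp add: del_short_def N_def)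
    have mem: "(i, j) \<in># del_short g C \<longleftrightarrow> (\<exists>i' j'. (i', j') \<in># N \<and> i = unskip g i' \<and> j = unskip g j')" for i j
      unfolding D by force
    have id: "ins_short g (del_short g C) = C"
    proof -
      have "image_mset (\<lambda>p. map_prod (skip g) (skip g) (map_prod (unskip g) (unskip g) p)) N = image_mset (\<lambda>p. p) N"
        by (rule image_mset_cong) (auto simp: skip_simps dest: ne)
      then show ?thesis unfolding ins_short_def D by (simp add: CN multiset.map_comp comp_def)
    qed
    have bd: "i \<le> j \<and> j < k" if ij0: "(i, j) \<in># del_short g C" for i j
    proof -
      obtain i' j' where ij: "(i', j') \<in># N" "i = unskip g i'" "j = unskip g j'"
        using ij0 unfolding mem by blast
      then have "(i', j') \<in># C" by (simp add: CN)
      then have "i' \<le> j'" "j' < Suc k" "i' \<noteq> g" "j' \<noteq> g"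
        using fishburnD(1,3)[OF f, of i' j'] ne[OF ij(1)] k by auto
      then show ?thesis using gk ij by (auto simp: unskip_def)
    qed
    have row: "\<exists>j. (i, j) \<in># del_short g C" if "i < k" for i
    proof -
      have "skip g i < mdim C" using that by (simp add: skip_def k)
      then obtain j where "(skip g i, j) \<in># C" using fishburnD(4)[OF f] by blast
      then have "(skip g i, j) \<in># N" by (simp add: CN skip_simps)
      then show ?thesis unfolding mem using skip_simps(2) by metis
    qed
    have col: "\<exists>i. (i, j) \<in># del_short g C" if "j < k" for j
    proof -
      have "skip g j < mdim C" using that by (simp add: skip_def k)
      then obtain i where "(i, skip g j) \<in># C" using fishburnD(5)[OF f] by blast
      then have "(i, skip g j) \<in># N" by (simp add: CN skip_simps)
      then show ?thesis unfolding mem using skip_simps(2) by metis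
    qed
    have "fishburn (del_short g C)" "mdim (del_short g C) = k" using fishburnI[OF bd row col] by auto
    then show ?thesis using id gk sz unfolding fishburns_def D by (simp add: CN)
  qed
  show "\<forall>a\<in>SIGMA C:fishburns (Suc n). shorts C. (\<lambda>(M, g). (ins_short g M, g)) ((\<lambda>(C, g). (del_short g C, g)) a) = a"
    using * by auto
  show "(\<lambda>(C, g). (del_short g C, g)) ` (SIGMA C:fishburns (Suc n). shorts C) \<subseteq> (SIGMA M:fishburns n. {..mdim M})"
    using * by auto
qed

section \<open>Approximate Poisson law for the number of short arcs\<close>

text \<open>Stein's method for the Poisson distribution with mean 1: the exact equations p r = (r +
  1) p (r + 1) would give p r = p 0 / r! and so p 0 = 1/e. The weights \<open>w\<close> are e times
  the solution of the Stein equation for the event r = 0, and their bound turns the summed defect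
  into the error.\<close>

lemma approx_poisson:
  fixes p :: "nat \<Rightarrow> real"
  assumes sum1: "(\<Sum>r\<le>m. p r) = 1" and fin: "\<And>r. r > m \<Longrightarrow> p r = 0"
    and eps: "(\<Sum>r\<le>m. \<bar>p r - real (Suc r) * p (Suc r)\<bar>) \<le> \<epsilon>"
  shows "\<bar>exp 1 * p 0 - 1\<bar> \<le> 2 * \<epsilon>"
proof -
  txt \<open>These weights satisfy \<open>w (i + 1) = (i + 1) * w i - 1\<close>, so the weighted differences telescope.\<close>
  define w where "w = (\<lambda>i. fact i * (exp 1 - (\<Sum>r\<le>i. 1 / fact r :: real)))"
  have e: "(\<lambda>r. 1 / fact r :: real) sums exp 1"
    using exp_converges[of "1::real"] by (simp add: divide_inverse)
  have tail: "(\<lambda>j. fact i / fact (j + Suc i) :: real) sums w i" for i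
  proof -
    have "(\<lambda>j. 1 / fact (j + Suc i) :: real) sums (exp 1 - (\<Sum>r<Suc i. 1 / fact r))"
      using e by (rule sums_split_initial_segment)
    from sums_mult[OF this, of "fact i"] show ?thesis by (simp add: w_def lessThan_Suc_atMost)
  qed
  have w_ge: "w i \<ge> 0" for i
    using sums_le[OF _ sums_zero tail[of i]] by simp
  \<comment> \<open>Each term of the tail series is largest for i = 0, because i! (j + 1)! divides
    (i + j + 1)!; and w 0 = e - 1.\<close>
  have w_le: "w i \<le> 2" for i
  proof -
    have "w i \<le> w 0"
    proof (rule sums_le[OF _ tail tail])
      fix j
      have "fact i * fact (Suc j) \<le> (fact (j + Suc i) :: nat)"
        using fact_fact_dvd_fact[of i "Suc j", where 'a = nat] by (intro dvd_imp_le) (auto simp: add.commute simp del: fact_Suc)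
      then have "real (fact i * fact (Suc j)) \<le> real (fact (j + Suc i))" by linarith
      then show "fact i / fact (j + Suc i) \<le> (fact 0 / fact (j + Suc 0) :: real)"
        by (simp add: field_simps del: fact_Suc)
    qed
    also have "w 0 \<le> 2" using exp_le by (simp add: w_def)
    finally show ?thesis .
  qed
  have w_Suc: "w (Suc i) = real (Suc i) * w i - 1" for i
  proof -
    have "w (Suc i) = fact (Suc i) * (exp 1 - (\<Sum>r\<le>i. 1 / fact r)) - fact (Suc i) * (1 / fact (Suc i))"
      by (simp add: w_def algebra_simps del: fact_Suc)
    moreover have "fact (Suc i) * (1 / fact (Suc i)) = (1 :: real)"
      by (simp del: fact_Suc)
    ultimately show ?thesis by (simp add: w_def)
  qed
  have "(\<Sum>i\<le>m. w i * (p i - real (Suc i) * p (Suc i))) = exp 1 * p 0 - (\<Sum>i\<le>m. p i) - real (Suc m) * w m * p (Suc m)"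
  proof (induction m)
    case 0 show ?case by (simp add: w_def algebra_simps)
  next
    case (Suc m)
    show ?case unfolding sum.atMost_Suc Suc.IH by (simp add: w_Suc algebra_simps)
  qed
  then have "exp 1 * p 0 - 1 = (\<Sum>i\<le>m. w i * (p i - real (Suc i) * p (Suc i)))"
    using sum1 fin[of "Suc m"] by simp
  also have "\<bar>\<dots>\<bar> \<le> (\<Sum>i\<le>m. 2 * \<bar>p i - real (Suc i) * p (Suc i)\<bar>)"
    using w_ge w_le by (intro order_trans[OF sum_abs] sum_mono) (auto simp: abs_mult intro!: mult_right_mono)
  also have "\<dots> \<le> 2 * \<epsilon>" using eps by (simp flip: sum_distrib_left)
  finally show ?thesis .
qed

text \<open>Double counting of matrices with a marked short index. Removing the marked arc lowers
  the number of short arcs by one, whence the \<open>Suc\<close>. Taking for h the indicator of r +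
  1 yields (r + 1) N_{r+1}.\<close>

lemma sum_card_shorts:
  fixes h :: "nat \<Rightarrow> real"
  shows "(\<Sum>C\<in>fishburns (Suc n). real (card (shorts C)) * h (card (shorts C))) =
    (\<Sum>M\<in>fishburns n. (real (mdim M) + 1) * h (Suc (card (shorts M))))"
proof -
  have "(\<Sum>(M, g)\<in>(SIGMA M:fishburns n. {..mdim M}). h (card (shorts (ins_short g M)))) =
     (\<Sum>(C, g)\<in>(SIGMA C:fishburns (Suc n). shorts C). h (card (shorts C)))"
    using sum.reindex_bij_betw[OF bij_betw_ins_short, of "\<lambda>(C, g). h (card (shorts C))" n]
    by (simp add: case_prod_beta')
  then have "(\<Sum>M\<in>fishburns n. \<Sum>g\<le>mdim M. h (card (shorts (ins_short g M)))) =
     (\<Sum>C\<in>fishburns (Suc n). \<Sum>g\<in>shorts C. h (card (shorts C)))"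
    by (simp add: sum.Sigma finite_fishburns del: sum_constant)
  then show ?thesis by (simp add: card_shorts_ins_short add.commute)
qed

text \<open>\<open>child\<close> interferes only with t and the last index. When an entry is
  increased, neither is short before or after. When a row and a column are inserted, the new index t
  and the new last index are not short, and the short ones are only renumbered.\<close>

lemma shorts_child:
  assumes f: "fishburn M" and t: "t < mdim M" "t \<notin> shorts M" "mdim M - 1 \<notin> shorts M"
  shows "card (shorts (child M t)) = card (shorts M)"
proof -
  define k where "k = mdim M"
  note F = fishburnD[OF f, folded k_def]
  note t = t[folded k_def]
  have "M \<noteq> {#}" using t k_def by auto
  note T = top_row[OF f this, folded k_def]
  show ?thesis
  proof (cases "t \<le> top_row M")
    case True
    then have C: "child M t = add_mset (t, k - 1) M" using t by (simp add: child_def k_def Let_def)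
    have "i \<in> shorts (child M t) \<longleftrightarrow> i \<in> shorts M" for i
    proof (cases "i = t \<or> i = k - 1")
      case True
      have "\<exists>q. q \<in># M \<and> touching i q" using True F(4)[OF t(1)] T(4) by (fastforce simp: touching_def)
      then have "i \<notin> shorts (child M t)"
        unfolding C using not_shorts_add_mset True by (metis fst_conv snd_conv touching_def)
      then show ?thesis using True t by blast
    next
      case False
      then show ?thesis unfolding C by (intro shorts_add_mset) (auto simp: touching_def)
    qed
    then have "shorts (child M t) = shorts M" by blast
    then show ?thesis by simp
  next
    case False
    then have C: "child M t = add_mset (t, k) (image_mset (split_at t k) M)"
      using t by (simp add: child_def k_def Let_def)
    \<comment> \<open>The new entry \<open>(t, k)\<close> is off the diagonal and touches both
      indices.\<close>
    have notin: "i \<notin> shorts (child M t)" if "i = t \<or> i = k" for i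
      using that t(1) shortsD(2,3)[of i "child M t"] by (auto simp: C)
    have iff: "skip t i \<in> shorts (child M t) \<longleftrightarrow> i \<in> shorts M" if "i \<noteq> k - 1" for i
    proof -
      have "skip t i \<noteq> k" using that t(1) by (auto simp: skip_def split: if_splits)
      then have "skip t i \<in> shorts (child M t) \<longleftrightarrow> skip t i \<in> shorts (image_mset (split_at t k) M)"
        unfolding C by (intro shorts_add_mset) (auto simp: touching_def skip_simps(1)[symmetric])
      also have "\<dots> \<longleftrightarrow> i \<in> shorts M"
        using that by (intro shorts_image_mset) (auto simp: touching_def split_at_def skip_simps skip_simps(1)[symmetric] split: if_splits)
      finally show ?thesis .
    qed
    have "shorts (child M t) = skip t ` shorts M"
    proof (intro set_eqI iffI)
      fix i assume i: "i \<in> shorts (child M t)"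
      then have "i \<noteq> t" "i \<noteq> k" using notin by blast+
      then have "i = skip t (unskip t i)" "unskip t i \<noteq> k - 1"
        using skip_simps(3) t(1) by (auto simp: unskip_def split: if_splits)
      then show "i \<in> skip t ` shorts M" using iff i by (metis imageI)
    next
      fix i assume "i \<in> skip t ` shorts M"
      then obtain i' where "i = skip t i'" "i' \<in> shorts M" by blast
      then show "i \<in> shorts (child M t)" using iff t(3) by metis
    qed
    then show ?thesis by (simp add: card_image[OF inj_on_subset[OF inj_skip]])
  qed
qed

text \<open>A smaller label puts an entry into the last column that keeps it from being a lone
  diagonal 1. So each parent has at most one child with a short last index, which makes such
  matrices rare.\<close>

lemma last_short_child:
  assumes f: "fishburn M" and t: "t \<le> mdim M" and s: "mdim (child M t) - 1 \<in> shorts (child M t)"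
  shows "t = mdim M"
proof (rule ccontr)
  assume "t \<noteq> mdim M"
  then have tk: "t < mdim M" using t by simp
  define k where "k = mdim M"
  have ne: "M \<noteq> {#}" using tk by auto
  note T = top_row[OF f ne]
  show False
  proof (cases "t \<le> top_row M")
    case True
    then have C: "child M t = add_mset (t, k - 1) M" and "mdim (child M t) = k"
      using tk child_props(2)[OF f t] by (simp_all add: child_def k_def Let_def)
    moreover have "k - 1 \<notin> shorts (add_mset (t, k - 1) M)"
      using T(4) by (intro not_shorts_add_mset[of _ _ "(k - 1, k - 1)"]) (auto simp: touching_def k_def)
    ultimately show False using s by simp
  next
    case False
    then have C: "(t, k) \<in># child M t" and "mdim (child M t) = Suc k"
      using tk child_props(2)[OF f t] by (simp_all add: child_def k_def Let_def)
    then show False using shortsD(3)[of k "child M t" t] s tk by (simp add: k_def)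
  qed
qed

text \<open>Outside these pairs, \<open>child\<close> preserves the number of short indices.\<close>

definition exceptional :: "nat \<Rightarrow> ((nat \<times> nat) multiset \<times> nat) set" where
  "exceptional n = {(M, t) \<in> (SIGMA M:fishburns n. {..mdim M}). t = mdim M \<or> t \<in> shorts M \<or> mdim M - 1 \<in> shorts M}"

text \<open>Let f be the cardinality of \<open>fishburns (Suc n)\<close>. The labels
  \<open>mdim M\<close> contribute f pairs, and marked short indices contribute f again, by the two
  bijections with a common domain. A matrix with short last index arises from the largest label of
  its parent, so its labels number the parent's dimension plus 2; these sum to at most 2 f.\<close>

lemma card_exceptional: "card (exceptional (Suc n)) \<le> 4 * card (fishburns (Suc n))"
proof -
  let ?F = "fishburns (Suc n)"
  let ?f = "card ?F"
  define B where "B = {M \<in> ?F. mdim M - 1 \<in> shorts M}"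
  have sub: "exceptional (Suc n) \<subseteq> (\<lambda>M. (M, mdim M)) ` ?F \<union> (SIGMA M:?F. shorts M) \<union> (SIGMA M:B. {..mdim M})"
    by (auto simp: exceptional_def B_def)
  have "card (exceptional (Suc n)) \<le> card ((\<lambda>M. (M, mdim M)) ` ?F) + card (SIGMA M:?F. shorts M) + card (SIGMA M:B. {..mdim M})"
    by (rule order_trans[OF card_mono[OF _ sub]])
       (auto intro!: order_trans[OF card_Un_le] simp: finite_fishburns B_def)
  moreover have "card ((\<lambda>M. (M, mdim M)) ` ?F) \<le> ?f" by (rule card_image_le) (rule finite_fishburns)
  moreover have "card (SIGMA M:?F. shorts M) = ?f"
    using bij_betw_same_card[OF bij_betw_ins_short[of n]] bij_betw_same_card[OF bij_betw_child[of n]] by simp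
  moreover have "card (SIGMA M:B. {..mdim M}) \<le> 2 * ?f"
  proof -
    have "card (SIGMA M:B. {..mdim M}) = (\<Sum>M\<in>?F. if mdim M - 1 \<in> shorts M then Suc (mdim M) else 0)"
      by (simp add: B_def finite_fishburns sum.inter_filter)
    also have "\<dots> = (\<Sum>M\<in>fishburns n. \<Sum>t\<le>mdim M. if mdim (child M t) - 1 \<in> shorts (child M t) then Suc (mdim (child M t)) else 0)"
      by (rule sum_fishburns_Suc)
    also have "\<dots> \<le> (\<Sum>M\<in>fishburns n. \<Sum>t\<le>mdim M. if t = mdim M then mdim M + 2 else 0)"
    proof (intro sum_mono)
      fix M t assume "M \<in> fishburns n" "t \<in> {..mdim M}"
      then have M: "fishburn M" and t: "t \<le> mdim M" by (auto simp: fishburns_def)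
      show "(if mdim (child M t) - 1 \<in> shorts (child M t) then Suc (mdim (child M t)) else 0)
          \<le> (if t = mdim M then mdim M + 2 else 0)"
      proof (cases "mdim (child M t) - 1 \<in> shorts (child M t)")
        case True
        then have "t = mdim M" by (rule last_short_child[OF M t])
        then show ?thesis using child_props(2)[OF M t] by simp
      qed simp
    qed
    also have "\<dots> = (\<Sum>M\<in>fishburns n. Suc (mdim M) + 1)" by simp
    also have "\<dots> = ?f + card (fishburns n)"
      unfolding sum.distrib by (simp add: card_fishburns_Suc)
    also have "\<dots> \<le> 2 * ?f" using card_fishburns_le_Suc[of n] by simp
    finally show ?thesis .
  qed
  ultimately show ?thesis by linarith
qed

text \<open>Among the pairs in \<Sigma>, \<open>N r\<close> counts those whose child has r short
  indices, and (r + 1) times \<open>N (Suc r)\<close> those whose matrix has r. Only exceptional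
  pairs are counted differently, and each contributes at most 2 to the sum over r. This gives 2 * 4
  = 8, which \<open>approx_poisson\<close> doubles to 16.\<close>

lemma shorts_free_ratio:
  "\<bar>exp 1 * (real (card {M \<in> fishburns (n + 2). shorts M = {}}) / real (card (fishburns (n + 2)))) - 1\<bar>
    \<le> 16 * real (card (fishburns (Suc n))) / real (card (fishburns (n + 2)))"
proof -
  define F where "F = fishburns (Suc (Suc n))"
  define f where "f = real (card F)"
  define ind where "ind = (\<lambda>(r::nat) (x::nat). if x = r then 1 else 0 :: real)"
  define N where "N = (\<lambda>r. \<Sum>M\<in>F. ind r (card (shorts M)))"
  define \<Sigma> where "\<Sigma> = (SIGMA M:fishburns (Suc n). {..mdim M})"
  let ?m = "n + 2"
  have f: "f > 0" using card_fishburns_pos by (simp add: f_def F_def)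
  have finF: "finite F" "finite \<Sigma>" by (auto simp: F_def \<Sigma>_def finite_fishburns)
  have le: "card (shorts M) \<le> ?m" if "M \<in> F" for M
    using card_shorts_le that by (fastforce simp: F_def fishburns_def)
  have indsum: "(\<Sum>r\<le>m. ind r x) \<le> 1" for x m by (simp add: ind_def sum.delta)
  have sumN: "(\<Sum>r\<le>?m. N r) = f"
  proof -
    have "(\<Sum>r\<le>?m. N r) = (\<Sum>M\<in>F. \<Sum>r\<le>?m. ind r (card (shorts M)))"
      unfolding N_def by (rule sum.swap)
    also have "\<dots> = (\<Sum>M\<in>F. 1)"
    proof (rule sum.cong[OF refl])
      fix M assume "M \<in> F"
      then have "card (shorts M) \<in> {..?m}" using le by simp
      then show "(\<Sum>r\<le>?m. ind r (card (shorts M))) = 1"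
        unfolding ind_def by (subst sum.delta') auto
    qed
    finally show ?thesis by (simp add: f_def)
  qed
  have N0: "N r = 0" if "r > ?m" for r
    unfolding N_def using le that by (intro sum.neutral) (fastforce simp: ind_def)
  have diff: "(\<Sum>r\<le>?m. \<bar>N r - real (Suc r) * N (Suc r)\<bar>) \<le> 8 * real (card (fishburns (Suc n)))"
  proof -
    have a: "N r = (\<Sum>(M, t)\<in>\<Sigma>. ind r (card (shorts (child M t))))" for r
      unfolding N_def F_def \<Sigma>_def by (simp add: sum_fishburns_Suc[of _ "Suc n"] sum.Sigma finite_fishburns)
    have b: "real (Suc r) * N (Suc r) = (\<Sum>(M, t)\<in>\<Sigma>. ind r (card (shorts M)))" for r
    proof -
      have "real (Suc r) * N (Suc r) = (\<Sum>M\<in>F. real (card (shorts M)) * ind (Suc r) (card (shorts M)))"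
        unfolding N_def sum_distrib_left by (rule sum.cong) (auto simp: ind_def)
      also have "\<dots> = (\<Sum>M\<in>fishburns (Suc n). (real (mdim M) + 1) * ind (Suc r) (Suc (card (shorts M))))"
        unfolding F_def by (rule sum_card_shorts)
      also have "\<dots> = (\<Sum>M\<in>fishburns (Suc n). \<Sum>t\<le>mdim M. ind r (card (shorts M)))"
        by (simp add: ind_def add.commute)
      finally show ?thesis unfolding \<Sigma>_def by (simp add: sum.Sigma finite_fishburns del: sum_constant)
    qed
    have "(\<Sum>r\<le>?m. \<bar>N r - real (Suc r) * N (Suc r)\<bar>) \<le>
       (\<Sum>r\<le>?m. \<Sum>(M, t)\<in>\<Sigma>. \<bar>ind r (card (shorts (child M t))) - ind r (card (shorts M))\<bar>)"
    proof (intro sum_mono)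
      fix r
      have "N r - real (Suc r) * N (Suc r) =
          (\<Sum>(M, t)\<in>\<Sigma>. ind r (card (shorts (child M t))) - ind r (card (shorts M)))"
        by (subst b) (simp add: a case_prod_beta' sum_subtractf)
      then show "\<bar>N r - real (Suc r) * N (Suc r)\<bar> \<le>
          (\<Sum>(M, t)\<in>\<Sigma>. \<bar>ind r (card (shorts (child M t))) - ind r (card (shorts M))\<bar>)"
        unfolding case_prod_beta' by (simp only: sum_abs)
    qed
    also have "\<dots> = (\<Sum>(M, t)\<in>\<Sigma>. \<Sum>r\<le>?m. \<bar>ind r (card (shorts (child M t))) - ind r (card (shorts M))\<bar>)"
      unfolding case_prod_beta' by (rule sum.swap)
    also have "\<dots> \<le> (\<Sum>p\<in>\<Sigma>. if p \<in> exceptional (Suc n) then 2 else 0)"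
    proof (intro sum_mono, clarify)
      fix M t assume p: "(M, t) \<in> \<Sigma>"
      show "(\<Sum>r\<le>?m. \<bar>ind r (card (shorts (child M t))) - ind r (card (shorts M))\<bar>)
          \<le> (if (M, t) \<in> exceptional (Suc n) then 2 else 0)"
      proof (cases "(M, t) \<in> exceptional (Suc n)")
        case True
        have "(\<Sum>r\<le>?m. \<bar>ind r (card (shorts (child M t))) - ind r (card (shorts M))\<bar>) \<le>
          (\<Sum>r\<le>?m. ind r (card (shorts (child M t))) + ind r (card (shorts M)))"
          by (intro sum_mono) (auto simp: ind_def)
        also have "\<dots> \<le> 2" using indsum[of "card (shorts (child M t))" ?m] indsum[of "card (shorts M)" ?m]
          unfolding sum.distrib by linarith
        finally show ?thesis using True by simp
      next
        case False
        then have "card (shorts (child M t)) = card (shorts M)"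
          using p by (intro shorts_child) (auto simp: exceptional_def \<Sigma>_def fishburns_def)
        then show ?thesis using False by simp
      qed
    qed
    also have "\<dots> = 2 * real (card (exceptional (Suc n)))"
    proof -
      have "{p \<in> \<Sigma>. p \<in> exceptional (Suc n)} = exceptional (Suc n)"
        by (auto simp: \<Sigma>_def exceptional_def)
      then show ?thesis using finF by (simp flip: sum.inter_filter)
    qed
    also have "\<dots> \<le> 8 * real (card (fishburns (Suc n)))" using card_exceptional[of n] by linarith
    finally show ?thesis .
  qed
  have "\<bar>exp 1 * (N 0 / f) - 1\<bar> \<le> 2 * (8 * real (card (fishburns (Suc n))) / f)"
  proof (rule approx_poisson[where m = ?m and p = "\<lambda>r. N r / f"])
    show "(\<Sum>r\<le>?m. N r / f) = 1" using sumN f by (simp flip: sum_divide_distrib)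
    show "N r / f = 0" if "r > ?m" for r using N0[OF that] by simp
    have "N r / f - real (Suc r) * (N (Suc r) / f) = (N r - real (Suc r) * N (Suc r)) / f" for r
      by (simp add: diff_divide_distrib)
    then have "(\<Sum>r\<le>?m. \<bar>N r / f - real (Suc r) * (N (Suc r) / f)\<bar>) = (\<Sum>r\<le>?m. \<bar>N r - real (Suc r) * N (Suc r)\<bar>) / f"
      using f by (simp only: abs_divide sum_divide_distrib abs_of_pos)
    then show "(\<Sum>r\<le>?m. \<bar>N r / f - real (Suc r) * (N (Suc r) / f)\<bar>) \<le> 8 * real (card (fishburns (Suc n))) / f"
      using diff f by (simp add: divide_right_mono)
  qed
  moreover have "N 0 = real (card {M \<in> F. shorts M = {}})"
    unfolding N_def ind_def using finF by (simp flip: sum.inter_filter)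
  ultimately show ?thesis by (simp add: F_def f_def)
qed

section \<open>Block decomposition\<close>

definition shift :: "nat \<Rightarrow> nat \<Rightarrow> nat \<Rightarrow> nat" where
  "shift g l i = (if i < g then i else i + l)"

definition unshift :: "nat \<Rightarrow> nat \<Rightarrow> nat \<Rightarrow> nat" where
  "unshift g l i = (if i < g then i else i - l)"

definition insert_block :: "nat \<Rightarrow> (nat \<times> nat) multiset \<Rightarrow> (nat \<times> nat) multiset \<Rightarrow> (nat \<times> nat) multiset" where
  "insert_block g B M = image_mset (map_prod (shift g (mdim B)) (shift g (mdim B))) M
     + image_mset (map_prod ((+) g) ((+) g)) B"

text \<open>In the diagram, the runs numbered g to g + l - 1 form an interval of points closed under
  taking mates.\<close>

definition is_block :: "nat \<Rightarrow> nat \<Rightarrow> (nat \<times> nat) multiset \<Rightarrow> bool" where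
  "is_block g l M \<longleftrightarrow> g + l \<le> mdim M \<and>
     (\<forall>i j. (i, j) \<in># M \<longrightarrow> (i \<in> {g..<g + l} \<longleftrightarrow> j \<in> {g..<g + l}))"

text \<open>A row or column of C lies entirely inside or entirely outside the block, so closing up
  the indices leaves no zero row or column in either part.\<close>

lemma block_decomposition:
  assumes f: "fishburn C" and bl: "is_block g l C"
  obtains M B where "fishburn M" "fishburn B" "mdim B = l" "mdim M + l = mdim C" "g \<le> mdim M"
    "C = insert_block g B M"
proof -
  let ?in = "\<lambda>p. fst p \<in> {g..<g + l}"
  define k where "k = mdim C - l"
  have k: "mdim C = k + l" "g \<le> k" using bl by (auto simp: is_block_def k_def)
  note F = fishburnD[OF f, unfolded k]
  have cl: "i \<in> {g..<g + l} \<longleftrightarrow> j \<in> {g..<g + l}" if "(i, j) \<in># C" for i j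
    using bl that by (auto simp: is_block_def)
  define N where "N = filter_mset (\<lambda>p. \<not> ?in p) C"
  define M where "M = image_mset (map_prod (unshift g l) (unshift g l)) N"
  define B where "B = image_mset (map_prod (\<lambda>i. i - g) (\<lambda>i. i - g)) (filter_mset ?in C)"
  have memN: "(i, j) \<in># N \<longleftrightarrow> (i, j) \<in># C \<and> i \<notin> {g..<g + l}" for i j by (auto simp: N_def)
  have memM: "(i, j) \<in># M \<longleftrightarrow> (\<exists>i' j'. (i', j') \<in># N \<and> i = unshift g l i' \<and> j = unshift g l j')" for i j
    unfolding M_def by force
  have memB: "(i, j) \<in># B \<longleftrightarrow> (\<exists>i' j'. (i', j') \<in># C \<and> i' \<in> {g..<g + l} \<and> i = i' - g \<and> j = j' - g)" for i j
    unfolding B_def by force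
  have us: "unshift g l (shift g l i) = i" "shift g l i \<notin> {g..<g + l}" for i
    by (auto simp: unshift_def shift_def)
  have su: "shift g l (unshift g l i) = i" if "i \<notin> {g..<g + l}" for i
    using that by (auto simp: unshift_def shift_def)
  have bdM: "i \<le> j \<and> j < k" if ij: "(i, j) \<in># M" for i j
  proof -
    obtain i' j' where *: "(i', j') \<in># N" "i = unshift g l i'" "j = unshift g l j'"
      using ij unfolding memM by blast
    then show ?thesis using F(1,3)[of i' j'] cl[of i' j'] k(2) unfolding memN by (auto simp: unshift_def)
  qed
  have rowM: "\<exists>j. (i, j) \<in># M" if i: "i < k" for i
  proof -
    have "shift g l i < k + l" using i by (simp add: shift_def)
    then obtain j where "(shift g l i, j) \<in># C" using F(4) by blast
    then show ?thesis unfolding memM memN using us by metis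
  qed
  have colM: "\<exists>i. (i, j) \<in># M" if j: "j < k" for j
  proof -
    have "shift g l j < k + l" using j by (simp add: shift_def)
    then obtain i where "(i, shift g l j) \<in># C" using F(5) by blast
    then show ?thesis unfolding memM memN using us cl by metis
  qed
  have bdB: "i \<le> j \<and> j < l" if ij: "(i, j) \<in># B" for i j
    using ij F(1) cl unfolding memB by fastforce
  have rowB: "\<exists>j. (i, j) \<in># B" if i: "i < l" for i
  proof -
    obtain j where "(g + i, j) \<in># C" using F(4)[of "g + i"] i k(2) by auto
    then show ?thesis unfolding memB using i by (intro exI[of _ "j - g"] exI[of _ "g + i"] exI[of _ j]) auto
  qed
  have colB: "\<exists>i. (i, j) \<in># B" if j: "j < l" for j
  proof -
    obtain i where i: "(i, g + j) \<in># C" using F(5)[of "g + j"] j k(2) by auto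
    then have "i \<in> {g..<g + l}" using cl[OF i] j by simp
    then show ?thesis unfolding memB using i j by (intro exI[of _ "i - g"] exI[of _ i] exI[of _ "g + j"]) auto
  qed
  have M: "fishburn M" "mdim M = k" using fishburnI[OF bdM rowM colM] by auto
  have B: "fishburn B" "mdim B = l" using fishburnI[OF bdB rowB colB] by auto
  have "C = filter_mset (\<lambda>p. \<not> ?in p) C + filter_mset ?in C"
    by (metis add.commute multiset_partition)
  also have "filter_mset (\<lambda>p. \<not> ?in p) C = image_mset (map_prod (shift g l) (shift g l)) M"
  proof -
    have "image_mset (\<lambda>p. map_prod (shift g l) (shift g l) (map_prod (unshift g l) (unshift g l) p)) N = image_mset (\<lambda>p. p) N"
    proof (rule image_mset_cong)
      fix p assume "p \<in># N"
      then obtain i j where p: "p = (i, j)" "(i, j) \<in># N" by (cases p) auto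
      then have "i \<notin> {g..<g + l}" "j \<notin> {g..<g + l}" using cl[of i j] unfolding memN by blast+
      then show "map_prod (shift g l) (shift g l) (map_prod (unshift g l) (unshift g l) p) = p"
        using su p(1) by (metis map_prod_simp)
    qed
    then show ?thesis by (simp add: M_def N_def multiset.map_comp comp_def)
  qed
  also have "filter_mset ?in C = image_mset (map_prod ((+) g) ((+) g)) B"
  proof -
    have "image_mset (\<lambda>p. map_prod ((+) g) ((+) g) (map_prod (\<lambda>i. i - g) (\<lambda>i. i - g) p)) (filter_mset ?in C) = image_mset (\<lambda>p. p) (filter_mset ?in C)"
      by (rule image_mset_cong) (use cl in fastforce)
    then show ?thesis by (simp add: B_def multiset.map_comp comp_def)
  qed
  finally have "C = insert_block g B M" by (simp add: insert_block_def B)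
  then show ?thesis using that M B k by simp
qed

lemma fishburns_1: "fishburns 1 = {{#(0, 0)#}}"
proof -
  have "fishburns (Suc 0) = (\<lambda>(M, t). child M t) ` (SIGMA M:fishburns 0. {..mdim M})"
    using bij_betw_child[of 0] by (simp add: bij_betw_def)
  also have "(SIGMA M:fishburns 0. {..mdim M}) = {({#}, 0)}" by (auto simp: fishburns_0)
  also have "(\<lambda>(M, t). child M t) ` {({#}, 0)} = {{#(0, 0)#}}" by (simp add: child_def)
  finally show ?thesis by simp
qed

text \<open>Excludes an outer diagram with one arc: its gaps lie before and after that arc, never
  inside, so the arc stays short.\<close>

lemma shorts_insert_block_left:
  assumes "M = {#(0, 0)#}" "fishburn B"
  shows "shift g (mdim B) 0 \<in> shorts (insert_block g B M)"
proof -
  have "filter_mset (touching (shift g (mdim B) 0)) (image_mset (map_prod ((+) g) ((+) g)) B) = {#}"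
    using fishburnD(2,3)[OF assms(2)] by (fastforce simp: filter_mset_eq_conv touching_def shift_def)
  then show ?thesis by (simp add: insert_block_def shorts_def assms(1) touching_def)
qed

lemma shorts_insert_block_right:
  assumes "B = {#(0, 0)#}"
  shows "g \<in> shorts (insert_block g B M)"
proof -
  have "mdim B = 1" by (simp add: assms mdim_def)
  then have "filter_mset (touching g) (image_mset (map_prod (shift g (mdim B)) (shift g (mdim B))) M) = {#}"
    by (auto simp: filter_mset_eq_conv touching_def shift_def split: if_splits)
  then show ?thesis by (simp add: insert_block_def shorts_def assms touching_def)
qed

definition decomposable :: "nat \<Rightarrow> (nat \<times> nat) multiset set" where
  "decomposable n = {C \<in> fishburns n. shorts C = {} \<and> (\<exists>g l. 0 < l \<and> l < mdim C \<and> is_block g l C)}"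

text \<open>The second factor counts outer matrices of size n - s with a chosen gap, by the
  recursion for the cardinalities. Absence of short indices keeps both parts at size at least 2,
  which removes the dominant term s = 1.\<close>

lemma card_decomposable:
  "card (decomposable n) \<le> (\<Sum>s=2..n-2. card (fishburns s) * card (fishburns (n + 1 - s)))"
proof -
  define D where "D = (\<lambda>s. (SIGMA M:fishburns (n - s). {..mdim M}) \<times> fishburns s)"
  have finD: "finite (D s)" for s by (auto simp: D_def finite_fishburns)
  have cardD: "card (D s) = card (fishburns s) * card (fishburns (n + 1 - s))" if "s \<le> n" for s
    using that card_fishburns_Suc[of "n - s"]
    by (simp add: D_def card_cartesian_product finite_fishburns Suc_diff_le mult.commute)
  have "decomposable n \<subseteq> (\<Union>s\<in>{2..n-2}. (\<lambda>((M, g), B). insert_block g B M) ` D s)"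
  proof
    fix C assume "C \<in> decomposable n"
    then obtain g l where f: "fishburn C" and sz: "size C = n" and sh: "shorts C = {}"
      and l: "0 < l" "l < mdim C" and bl: "is_block g l C"
      by (auto simp: decomposable_def fishburns_def)
    obtain M B where MB: "fishburn M" "fishburn B" "mdim B = l" "mdim M + l = mdim C" "g \<le> mdim M"
      "C = insert_block g B M" using block_decomposition[OF f bl] .
    define s where "s = size B"
    have n: "n = size M + s" using sz MB(6) by (simp add: insert_block_def s_def)
    have "B \<noteq> {#}" "M \<noteq> {#}" using MB l by auto
    then have "size M \<noteq> 0" "s \<noteq> 0" by (auto simp: s_def)
    moreover have "s \<noteq> 1"
    proof
      assume "s = 1"
      then have "B \<in> fishburns 1" using MB by (simp add: fishburns_def s_def)
      then have "B = {#(0, 0)#}" unfolding fishburns_1 by simp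
      then show False using shorts_insert_block_right[of B g M] MB(6) sh by simp
    qed
    moreover have "size M \<noteq> 1"
    proof
      assume "size M = 1"
      then have "M \<in> fishburns 1" using MB by (simp add: fishburns_def)
      then have "M = {#(0, 0)#}" unfolding fishburns_1 by simp
      then show False using shorts_insert_block_left[of M B g] MB(2,6) sh by simp
    qed
    ultimately have "s \<in> {2..n-2}" unfolding atLeastAtMost_iff using n by linarith
    moreover have "((M, g), B) \<in> D s" using MB n by (simp add: D_def fishburns_def s_def)
    ultimately show "C \<in> (\<Union>s\<in>{2..n-2}. (\<lambda>((M, g), B). insert_block g B M) ` D s)"
      using MB(6) by force
  qed
  then have "card (decomposable n) \<le> card (\<Union>s\<in>{2..n-2}. (\<lambda>((M, g), B). insert_block g B M) ` D s)"
    by (intro card_mono) (auto simp: finD)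
  also have "\<dots> \<le> (\<Sum>s=2..n-2. card ((\<lambda>((M, g), B). insert_block g B M) ` D s))"
    by (rule card_UN_le) simp
  also have "\<dots> \<le> (\<Sum>s=2..n-2. card (D s))" by (intro sum_mono card_image_le finD)
  also have "\<dots> = (\<Sum>s=2..n-2. card (fishburns s) * card (fishburns (n + 1 - s)))"
    by (intro sum.cong refl cardD) auto
  finally show ?thesis .
qed

section \<open>Regular involutions and Fishburn matrices\<close>

text \<open>A closer followed by an opener, hence the boundary between two pairs of an opener run
  and the closer run after it. \<open>run\<close> numbers these pairs from 0, so both runs of a pair
  share an index.\<close>

definition descent :: "(nat \<Rightarrow> nat) \<Rightarrow> nat \<Rightarrow> bool" where
  "descent \<mu> x \<longleftrightarrow> \<mu> x < x \<and> Suc x < \<mu> (Suc x)"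

definition run :: "(nat \<Rightarrow> nat) \<Rightarrow> nat \<Rightarrow> nat" where
  "run \<mu> x = card {y \<in> {1..<x}. descent \<mu> y}"

definition matrix :: "nat \<Rightarrow> (nat \<Rightarrow> nat) \<Rightarrow> (nat \<times> nat) multiset" where
  "matrix N \<mu> = image_mset (\<lambda>x. (run \<mu> x, run \<mu> (\<mu> x))) (mset_set {x \<in> {1..N}. x < \<mu> x})"

text \<open>
  The key of a point lists its run, its type (0 for openers, 1 for closers), the run of its mate and
  a counter for parallel arcs. Regularity makes the keys lexicographically increasing, and
  the set of keys depends on the matrix only; this recovers the diagram from its matrix.
\<close>

definition key0 :: "(nat \<Rightarrow> nat) \<Rightarrow> nat \<Rightarrow> nat \<times> nat \<times> nat" where
  "key0 \<mu> x = (run \<mu> x, if x < \<mu> x then 0 else 1, run \<mu> (\<mu> x))"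

definition occ :: "(nat \<Rightarrow> nat) \<Rightarrow> nat \<Rightarrow> nat" where
  "occ \<mu> x = card {y \<in> {1..<x}. key0 \<mu> y = key0 \<mu> x}"

definition key :: "(nat \<Rightarrow> nat) \<Rightarrow> nat \<Rightarrow> nat \<times> nat \<times> nat \<times> nat" where
  "key \<mu> x = (run \<mu> x, if x < \<mu> x then 0 else 1, run \<mu> (\<mu> x), occ \<mu> x)"

definition flip :: "nat \<times> nat \<times> nat \<times> nat \<Rightarrow> nat \<times> nat \<times> nat \<times> nat" where
  "flip = (\<lambda>(i, b, j, m). (j, 1 - b, i, m))"

definition keyset :: "(nat \<times> nat) multiset \<Rightarrow> (nat \<times> nat \<times> nat \<times> nat) set" where
  "keyset M = {(i, 0, j, m) |i j m. m < count M (i, j)} \<union> {(j, 1, i, m) |i j m. m < count M (i, j)}"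

lemma flip_keyset: "p \<in> keyset M \<Longrightarrow> flip p \<in> keyset M" "p \<in> keyset M \<Longrightarrow> flip (flip p) = p"
    "p \<in> keyset M \<Longrightarrow> flip p \<noteq> p"
  by (auto simp: keyset_def flip_def)

lemma card_keyset: "finite (keyset M)" "card (keyset M) = 2 * size M"
proof -
  define S where "S = (SIGMA p:set_mset M. {..<count M p})"
  define f where "f = (\<lambda>((i::nat, j::nat), m::nat). (i, 0::nat, j, m))"
  define g where "g = (\<lambda>((i::nat, j::nat), m::nat). (j, 1::nat, i, m))"
  have cS: "card S = size M" unfolding S_def by (simp add: size_multiset_overloaded_eq)
  have fS: "finite S" unfolding S_def by blast
  have eq: "keyset M = f ` S \<union> g ` S"
  proof -
    have "f ` S = {(i, 0, j, m) |i j m. m < count M (i, j)}"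
      by (force simp: f_def S_def image_iff intro: count_inI)
    moreover have "g ` S = {(j, 1, i, m) |i j m. m < count M (i, j)}"
      by (force simp: g_def S_def image_iff intro: count_inI)
    ultimately show ?thesis by (simp add: keyset_def)
  qed
  have "inj_on f S" "inj_on g S" by (auto simp: inj_on_def f_def g_def)
  then have "card (f ` S) = size M" "card (g ` S) = size M" using cS by (auto simp: card_image)
  moreover have "f ` S \<inter> g ` S = {}" by (auto simp: f_def g_def)
  ultimately show "card (keyset M) = 2 * size M" "finite (keyset M)"
    unfolding eq using fS by (simp_all add: card_Un_disjoint)
qed

lemma count_image_mset_set:
  "finite S \<Longrightarrow> count (image_mset f (mset_set S)) v = card {x \<in> S. f x = v}"
proof (induction S rule: finite_induct)
  case (insert a S)
  have "{x \<in> insert a S. f x = v} = (if f a = v then insert a {x \<in> S. f x = v} else {x \<in> S. f x = v})"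
    by auto
  then show ?case using insert by simp
qed simp

lemma count_matrix:
  "count (matrix N \<mu>) v = card {x \<in> {1..N}. x < \<mu> x \<and> (run \<mu> x, run \<mu> (\<mu> x)) = v}"
  unfolding matrix_def by (subst count_image_mset_set) (auto intro: arg_cong[where f = card])

lemma run_1 [simp]: "run \<mu> (Suc 0) = 0"
  by (simp add: run_def)

lemma run_Suc: "x \<ge> 1 \<Longrightarrow> run \<mu> (Suc x) = run \<mu> x + (if descent \<mu> x then 1 else 0)"
proof -
  assume "x \<ge> 1"
  then have eq: "{y \<in> {1..<Suc x}. descent \<mu> y} = {y \<in> {1..<x}. descent \<mu> y} \<union> (if descent \<mu> x then {x} else {})"
    by (auto simp: less_Suc_eq)
  show ?thesis unfolding run_def eq by (cases "descent \<mu> x") simp_all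
qed

lemma run_mono: "x \<le> y \<Longrightarrow> run \<mu> x \<le> run \<mu> y"
  unfolding run_def by (rule card_mono) auto

lemma run_cong:
  assumes "\<And>y. y \<in> {1..N} \<Longrightarrow> \<mu> y = \<mu>' y" "x \<le> N"
  shows "run \<mu> x = run \<mu>' x"
proof -
  have "{y \<in> {1..<x}. descent \<mu> y} = {y \<in> {1..<x}. descent \<mu>' y}"
  proof (intro Collect_cong conj_cong refl)
    fix y assume "y \<in> {1..<x}"
    then have "\<mu> y = \<mu>' y" "\<mu> (Suc y) = \<mu>' (Suc y)" using assms by auto
    then show "descent \<mu> y = descent \<mu>' y" by (simp add: descent_def)
  qed
  then show ?thesis by (simp add: run_def)
qed

section \<open>Run structure of a matching\<close>

locale involution =
  fixes N :: nat and \<mu> :: "nat \<Rightarrow> nat"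
  assumes mu_in: "x \<in> {1..N} \<Longrightarrow> \<mu> x \<in> {1..N}"
    and mu_ne: "x \<in> {1..N} \<Longrightarrow> \<mu> x \<noteq> x"
    and mu_mu: "x \<in> {1..N} \<Longrightarrow> \<mu> (\<mu> x) = x"
begin

lemma mu_eq_iff: "x \<in> {1..N} \<Longrightarrow> y \<in> {1..N} \<Longrightarrow> \<mu> x = \<mu> y \<longleftrightarrow> x = y"
  using mu_mu by metis

lemma card_openers: "2 * card {x \<in> {1..N}. x < \<mu> x} = N"
proof -
  let ?O = "{x \<in> {1..N}. x < \<mu> x}" and ?C = "{x \<in> {1..N}. \<mu> x < x}"
  have "bij_betw \<mu> ?O ?C"
    by (rule bij_betw_byWitness[where f' = \<mu>]) (use mu_in mu_mu in auto)
  then have "card ?O = card ?C" by (rule bij_betw_same_card)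
  moreover have "card (?O \<union> ?C) = card ?O + card ?C" by (rule card_Un_disjoint) auto
  moreover have "?O \<union> ?C = {1..N}"
  proof (intro set_eqI)
    fix x show "x \<in> ?O \<union> ?C \<longleftrightarrow> x \<in> {1..N}" using mu_ne[of x] by (auto simp: neq_iff)
  qed
  ultimately show ?thesis by simp
qed

lemma size_matrix: "2 * size (matrix N \<mu>) = N"
  using card_openers by (simp add: matrix_def)

lemma in_matrixI: "x \<in> {1..N} \<Longrightarrow> x < \<mu> x \<Longrightarrow> (run \<mu> x, run \<mu> (\<mu> x)) \<in># matrix N \<mu>"
  by (auto simp: matrix_def)

lemma in_matrixE:
  assumes "(i, j) \<in># matrix N \<mu>"
  obtains x where "x \<in> {1..N}" "x < \<mu> x" "run \<mu> x = i" "run \<mu> (\<mu> x) = j"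
  using assms by (auto simp: matrix_def)

text \<open>Point 1 opens run 0, and every later run begins with the opener that follows a descent;
  so no row of the matrix is zero.\<close>

lemma exists_opener_run:
  assumes "1 \<le> x" "x \<le> N" "i \<le> run \<mu> x"
  shows "\<exists>y\<in>{1..x}. y < \<mu> y \<and> run \<mu> y = i"
  using assms
proof (induction x rule: dec_induct)
  case base
  have "\<mu> 1 \<in> {1..N}" "\<mu> 1 \<noteq> 1" using mu_in[of 1] mu_ne[of 1] base by auto
  then show ?case using base by auto
next
  case (step x)
  show ?case
  proof (cases "i \<le> run \<mu> x")
    case True
    then obtain y where "y \<in> {1..x}" "y < \<mu> y \<and> run \<mu> y = i" using step.IH step.prems(1) by auto
    then show ?thesis by (intro bexI[of _ y]) auto
  next
    case False
    then have "descent \<mu> x" "run \<mu> (Suc x) = i"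
      using step.prems(2) run_Suc[OF step.hyps(1), of \<mu>] by (auto split: if_splits)
    then show ?thesis by (intro bexI[of _ "Suc x"]) (auto simp: descent_def)
  qed
qed

text \<open>A run that has been left ends in a descent, and the point of descent is a closer. The
  last run is never left and ends in the closer N instead.\<close>

lemma exists_closer_run_less:
  assumes "1 \<le> x" "i < run \<mu> x"
  shows "\<exists>y\<in>{1..x}. \<mu> y < y \<and> run \<mu> y = i"
  using assms
proof (induction x rule: dec_induct)
  case (step x)
  show ?case
  proof (cases "i < run \<mu> x")
    case True
    then obtain y where "y \<in> {1..x}" "\<mu> y < y \<and> run \<mu> y = i" using step.IH by auto
    then show ?thesis by (intro bexI[of _ y]) auto
  next
    case False
    then have "descent \<mu> x" "run \<mu> x = i"
      using step.prems run_Suc[OF step.hyps(1), of \<mu>] by (auto split: if_splits)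
    then show ?thesis using step.hyps by (intro bexI[of _ x]) (auto simp: descent_def)
  qed
qed simp

lemma exists_closer_run:
  assumes "N \<ge> 1" "i \<le> run \<mu> N"
  shows "\<exists>y\<in>{1..N}. \<mu> y < y \<and> run \<mu> y = i"
proof (cases "i = run \<mu> N")
  case True
  have "\<mu> N < N" using mu_in[of N] mu_ne[of N] assms by auto
  then show ?thesis using True assms by (intro bexI[of _ N]) auto
next
  case False
  then show ?thesis using exists_closer_run_less[of N i] assms by auto
qed

lemma fishburn_matrix:
  assumes "N \<ge> 1"
  shows "fishburn (matrix N \<mu>)" "mdim (matrix N \<mu>) = Suc (run \<mu> N)"
proof -
  have bd: "i \<le> j \<and> j < Suc (run \<mu> N)" if "(i, j) \<in># matrix N \<mu>" for i j
    using that
  proof (rule in_matrixE)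
    fix x assume "x \<in> {1..N}" "x < \<mu> x" "run \<mu> x = i" "run \<mu> (\<mu> x) = j"
    then show ?thesis using run_mono[of x "\<mu> x" \<mu>] run_mono[of "\<mu> x" N \<mu>] mu_in[of x] by simp
  qed
  have row: "\<exists>j. (i, j) \<in># matrix N \<mu>" if i: "i < Suc (run \<mu> N)" for i
    using exists_opener_run[of N i] i assms in_matrixI by fastforce
  have col: "\<exists>i. (i, j) \<in># matrix N \<mu>" if j: "j < Suc (run \<mu> N)" for j
  proof -
    obtain y where y: "y \<in> {1..N}" "\<mu> y < y" "run \<mu> y = j" using exists_closer_run[of j] j assms by auto
    then show ?thesis using in_matrixI[of "\<mu> y"] mu_in[OF y(1)] mu_mu[OF y(1)] by auto
  qed
  show "fishburn (matrix N \<mu>)" "mdim (matrix N \<mu>) = Suc (run \<mu> N)"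
    using fishburnI[OF bd row col] by auto
qed

text \<open>Within a run, an opener after a closer would create a descent and start a new
  run.\<close>

lemma closer_persistent:
  assumes "1 \<le> x" "\<mu> x < x" "x \<le> y" "y \<le> N" "run \<mu> y = run \<mu> x"
  shows "\<mu> y < y"
  using assms(3,4,5)
proof (induction y rule: dec_induct)
  case base
  then show ?case using assms by simp
next
  case (step y)
  have y: "y \<ge> 1" using assms(1) step.hyps by simp
  have "run \<mu> y = run \<mu> x" "\<not> descent \<mu> y"
    using run_Suc[OF y, of \<mu>] step.prems run_mono[OF step.hyps(1), of \<mu>] by (auto split: if_splits)
  then have "\<mu> y < y" "\<not> descent \<mu> y" using step by auto
  then show ?case using mu_ne[of "Suc y"] step.prems by (auto simp: descent_def)
qed

lemma matrix_cong:
  assumes "\<And>x. x \<in> {1..N} \<Longrightarrow> \<mu> x = \<mu>' x"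
  shows "matrix N \<mu> = matrix N \<mu>'"
proof -
  have "{x \<in> {1..N}. x < \<mu> x} = {x \<in> {1..N}. x < \<mu>' x}" using assms by auto
  moreover have "(run \<mu> x, run \<mu> (\<mu> x)) = (run \<mu>' x, run \<mu>' (\<mu>' x))" if "x \<in> {1..N}" for x
    using that run_cong[OF assms, of x] run_cong[OF assms, of "\<mu> x"] mu_in[OF that] assms by auto
  ultimately show ?thesis unfolding matrix_def by (auto intro!: image_mset_cong)
qed

end

section \<open>Keys of a regular matching\<close>

text \<open>A forbidden nesting consists of two neighbouring points of the same type whose mates
  decrease, so regularity is local monotonicity of the mate.\<close>

locale regular_involution = involution +
  assumes reg_openers: "1 \<le> x \<Longrightarrow> Suc x \<le> N \<Longrightarrow> x < \<mu> x \<Longrightarrow> Suc x < \<mu> (Suc x) \<Longrightarrow> \<mu> x < \<mu> (Suc x)"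
    and reg_closers: "1 \<le> x \<Longrightarrow> Suc x \<le> N \<Longrightarrow> \<mu> x < x \<Longrightarrow> \<mu> (Suc x) < Suc x \<Longrightarrow> \<mu> x < \<mu> (Suc x)"
begin

text \<open>Within its run an opener is preceded by openers only, so the local condition chains from
  x to y.\<close>

lemma mu_less_openers:
  assumes "1 \<le> x" "x < y" "y \<le> N" "run \<mu> y = run \<mu> x" "y < \<mu> y"
  shows "\<mu> x < \<mu> y"
proof -
  have "y \<le> N \<Longrightarrow> run \<mu> y = run \<mu> x \<Longrightarrow> y < \<mu> y \<Longrightarrow> \<mu> x \<le> \<mu> y \<and> (x < y \<longrightarrow> \<mu> x < \<mu> y)"
    using less_imp_le[OF assms(2)]
  proof (induction y rule: dec_induct)
    case (step y)
    have y: "y \<ge> 1" using assms(1) step.hyps by simp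
    have r: "run \<mu> y = run \<mu> x" "\<not> descent \<mu> y"
      using run_Suc[OF y, of \<mu>] step.prems run_mono[OF step.hyps(1), of \<mu>] by (auto split: if_splits)
    then have o: "y < \<mu> y" using step.prems mu_ne[of y] y by (auto simp: descent_def)
    then show ?case using step.IH reg_openers[of y] step.prems y r by auto
  qed simp
  then show ?thesis using assms by blast
qed

lemma mu_less_closers:
  assumes "1 \<le> x" "x < y" "y \<le> N" "run \<mu> y = run \<mu> x" "\<mu> x < x"
  shows "\<mu> x < \<mu> y"
proof -
  have "y \<le> N \<Longrightarrow> run \<mu> y = run \<mu> x \<Longrightarrow> \<mu> x \<le> \<mu> y \<and> (x < y \<longrightarrow> \<mu> x < \<mu> y)"
    using less_imp_le[OF assms(2)]
  proof (induction y rule: dec_induct)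
    case (step y)
    have y: "y \<ge> 1" using assms(1) step.hyps by simp
    have r: "run \<mu> y = run \<mu> x"
      using run_Suc[OF y, of \<mu>] step.prems run_mono[OF step.hyps(1), of \<mu>] by (auto split: if_splits)
    have "\<mu> y < y" using closer_persistent[OF assms(1,5) step.hyps(1)] step.prems r by simp
    moreover have "\<mu> (Suc y) < Suc y" using closer_persistent[OF assms(1,5), of "Suc y"] step.hyps step.prems by simp
    ultimately show ?case using step.IH reg_closers[of y] step.prems y r by auto
  qed simp
  then show ?thesis using assms by blast
qed

lemma same_class:
  assumes "x \<in> {1..N}" "y \<in> {1..N}" "x < y" "run \<mu> x = run \<mu> y" "x < \<mu> x \<longleftrightarrow> y < \<mu> y"
  shows "\<mu> x < \<mu> y"
proof (cases "y < \<mu> y")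
  case True
  then show ?thesis using mu_less_openers[of x y] assms by auto
next
  case False
  then have "\<mu> x < x" using assms mu_ne[of x] by auto
  then show ?thesis using mu_less_closers[of x y] assms by auto
qed

text \<open>Ties are broken in turn: in one run closers come last; points of the same run and type
  have increasing mates, so the runs of the mates do not decrease; if these agree too, x is counted
  in \<open>occ \<mu> y\<close> but not in \<open>occ \<mu> x\<close>.\<close>

lemma key_less:
  assumes "x \<in> {1..N}" "y \<in> {1..N}" "x < y"
  shows "key \<mu> x < key \<mu> y"
proof (cases "run \<mu> x = run \<mu> y")
  case False
  then show ?thesis using run_mono[of x y \<mu>] assms by (auto simp: key_def)
next
  case run: True
  show ?thesis
  proof (cases "x < \<mu> x \<longleftrightarrow> y < \<mu> y")
    case False
    moreover have "\<mu> y < y" if "\<mu> x < x" using closer_persistent[of x y] that assms run by auto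
    ultimately have "x < \<mu> x" "\<not> y < \<mu> y" using mu_ne[OF assms(1)] by auto
    then show ?thesis using run by (simp add: key_def)
  next
    case type: True
    have le: "run \<mu> (\<mu> x) \<le> run \<mu> (\<mu> y)" using same_class[OF assms run type] run_mono by simp
    have "occ \<mu> x < occ \<mu> y" if "run \<mu> (\<mu> x) = run \<mu> (\<mu> y)"
    proof -
      have "key0 \<mu> x = key0 \<mu> y" using that run type by (simp add: key0_def)
      then have "{z \<in> {1..<x}. key0 \<mu> z = key0 \<mu> x} \<subset> {z \<in> {1..<y}. key0 \<mu> z = key0 \<mu> y}"
        using assms by (auto intro!: psubsetI)
      then show ?thesis unfolding occ_def by (intro psubset_card_mono) auto
    qed
    then show ?thesis using le run type by (auto simp: key_def le_less)
  qed
qed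

text \<open>By \<open>same_class\<close>, \<mu> sends the earlier points parallel to x injectively
  to earlier points parallel to its mate. Used for the mate as well, this gives both ends of an arc
  the same counter.\<close>

lemma occ_mu_le:
  assumes x: "x \<in> {1..N}"
  shows "occ \<mu> x \<le> occ \<mu> (\<mu> x)"
  unfolding occ_def
proof (rule card_inj_on_le)
  show "inj_on \<mu> {y \<in> {1..<x}. key0 \<mu> y = key0 \<mu> x}"
    by (rule inj_onI) (use x mu_eq_iff in auto)
  show "\<mu> ` {y \<in> {1..<x}. key0 \<mu> y = key0 \<mu> x} \<subseteq> {y \<in> {1..<\<mu> x}. key0 \<mu> y = key0 \<mu> (\<mu> x)}"
  proof (rule image_subsetI, clarify)
    fix y assume y: "y \<in> {1..<x}" "key0 \<mu> y = key0 \<mu> x"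
    then have y1: "y \<in> {1..N}" "y < x" using x by auto
    have k: "run \<mu> y = run \<mu> x" "y < \<mu> y \<longleftrightarrow> x < \<mu> x" "run \<mu> (\<mu> y) = run \<mu> (\<mu> x)"
      using y(2) by (auto simp: key0_def split: if_splits)
    have "\<mu> y < \<mu> x" by (rule same_class) (use x y1 k in auto)
    moreover have "\<mu> y < y \<longleftrightarrow> \<mu> x < x" using k(2) mu_ne[OF x] mu_ne[OF y1(1)] by auto
    ultimately show "\<mu> y \<in> {1..<\<mu> x} \<and> key0 \<mu> (\<mu> y) = key0 \<mu> (\<mu> x)"
      using mu_in[OF y1(1)] k mu_mu[OF x] mu_mu[OF y1(1)] by (simp add: key0_def)
  qed
qed simp

lemma key_mu:
  assumes x: "x \<in> {1..N}"
  shows "key \<mu> (\<mu> x) = flip (key \<mu> x)"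
proof -
  have "occ \<mu> (\<mu> x) = occ \<mu> x"
    using occ_mu_le[OF x] occ_mu_le[OF mu_in[OF x]] mu_mu[OF x] by simp
  moreover have "\<mu> x < x \<longleftrightarrow> \<not> x < \<mu> x" using mu_ne[OF x] by auto
  ultimately show ?thesis using mu_mu[OF x] by (simp add: key_def flip_def)
qed

lemma key_in_keyset:
  assumes x: "x \<in> {1..N}"
  shows "key \<mu> x \<in> keyset (matrix N \<mu>)"
proof -
  have *: "key \<mu> x \<in> keyset (matrix N \<mu>)" if x: "x \<in> {1..N}" and o: "x < \<mu> x" for x
  proof -
    have "occ \<mu> x < count (matrix N \<mu>) (run \<mu> x, run \<mu> (\<mu> x))"
      unfolding occ_def count_matrix
    proof (rule psubset_card_mono)
      have "{y \<in> {1..<x}. key0 \<mu> y = key0 \<mu> x} \<subseteq> {y \<in> {1..N}. y < \<mu> y \<and> (run \<mu> y, run \<mu> (\<mu> y)) = (run \<mu> x, run \<mu> (\<mu> x))}"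
        using x o by (auto simp: key0_def split: if_splits)
      moreover have "x \<notin> {y \<in> {1..<x}. key0 \<mu> y = key0 \<mu> x}" by simp
      moreover have "x \<in> {y \<in> {1..N}. y < \<mu> y \<and> (run \<mu> y, run \<mu> (\<mu> y)) = (run \<mu> x, run \<mu> (\<mu> x))}"
        using x o by simp
      ultimately show "{y \<in> {1..<x}. key0 \<mu> y = key0 \<mu> x} \<subset> {y \<in> {1..N}. y < \<mu> y \<and> (run \<mu> y, run \<mu> (\<mu> y)) = (run \<mu> x, run \<mu> (\<mu> x))}"
        by blast
    qed simp
    then show ?thesis using o by (simp add: key_def keyset_def)
  qed
  show ?thesis
  proof (cases "x < \<mu> x")
    case True
    then show ?thesis using * x by blast
  next
    case False
    then have "\<mu> x < \<mu> (\<mu> x)" using mu_ne[OF x] mu_mu[OF x] by simp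
    then have "key \<mu> (\<mu> x) \<in> keyset (matrix N \<mu>)" using * mu_in[OF x] by blast
    then have "flip (key \<mu> (\<mu> x)) \<in> keyset (matrix N \<mu>)" by (rule flip_keyset)
    then show ?thesis using key_mu[OF mu_in[OF x]] mu_mu[OF x] by simp
  qed
qed

text \<open>The keys of the N points are distinct members of a set with
  \<open>2 * size (matrix N \<mu>)\<close> = N elements, so they exhaust it, and being increasing
  they enumerate it in order.\<close>

lemma key_eq_nth:
  assumes "x \<in> {1..N}"
  shows "key \<mu> x = sorted_list_of_set (keyset (matrix N \<mu>)) ! (x - 1)"
proof -
  have inj: "inj_on (key \<mu>) {1..N}"
  proof (rule linorder_inj_onI)
    fix x y assume "x < y" "x \<in> {1..N}" "y \<in> {1..N}"
    then show "key \<mu> x \<noteq> key \<mu> y" using key_less[of x y] by auto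
  qed auto
  have eq: "key \<mu> ` {1..N} = keyset (matrix N \<mu>)"
  proof (rule card_subset_eq)
    show "finite (keyset (matrix N \<mu>))" by (rule card_keyset)
    show "key \<mu> ` {1..N} \<subseteq> keyset (matrix N \<mu>)" using key_in_keyset by blast
    show "card (key \<mu> ` {1..N}) = card (keyset (matrix N \<mu>))"
      unfolding card_image[OF inj] card_keyset using size_matrix by simp
  qed
  have "map (key \<mu>) [1..<Suc N] = sorted_list_of_set (keyset (matrix N \<mu>))"
  proof (rule sorted_distinct_set_unique)
    show "sorted (map (key \<mu>) [1..<Suc N])"
      unfolding sorted_iff_nth_mono_less by (auto intro!: less_imp_le key_less simp del: upt_Suc)
    show "distinct (map (key \<mu>) [1..<Suc N])"
      using inj by (simp add: distinct_map atLeastLessThanSuc_atLeastAtMost del: upt_Suc)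
    show "set (map (key \<mu>) [1..<Suc N]) = set (sorted_list_of_set (keyset (matrix N \<mu>)))"
      using eq card_keyset(1) by (simp add: atLeastLessThanSuc_atLeastAtMost del: upt_Suc)
  qed auto
  moreover have "map (key \<mu>) [1..<Suc N] ! (x - 1) = key \<mu> x"
    using assms by (subst nth_map) (auto simp del: upt_Suc)
  ultimately show ?thesis by simp
qed

end

section \<open>Reconstruction of a regular matching from its matrix\<close>

lemma regular_involution_unique:
  assumes "regular_involution N \<mu>" "regular_involution N \<mu>'" "matrix N \<mu> = matrix N \<mu>'" "x \<in> {1..N}"
  shows "\<mu> x = \<mu>' x"
proof -
  interpret a: regular_involution N \<mu> by fact
  interpret b: regular_involution N \<mu>' by fact
  have k: "key \<mu> y = key \<mu>' y" if "y \<in> {1..N}" for y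
    using a.key_eq_nth[OF that] b.key_eq_nth[OF that] assms(3) by simp
  have "key \<mu> (\<mu> x) = key \<mu> (\<mu>' x)"
    using a.key_mu[OF assms(4)] b.key_mu[OF assms(4)] k[OF assms(4)] k[OF b.mu_in[OF assms(4)]] by simp
  then show ?thesis
    using a.key_less[OF a.mu_in[OF assms(4)] b.mu_in[OF assms(4)]] a.key_less[OF b.mu_in[OF assms(4)] a.mu_in[OF assms(4)]]
    by (metis less_irrefl nat_neq_iff)
qed

lemma keyset_bounds:
  assumes f: "fishburn M" and p: "(a, b, c, m) \<in> keyset M"
  shows "b \<le> 1" "a < mdim M" "b = 0 \<Longrightarrow> a \<le> c" "b = 1 \<Longrightarrow> c \<le> a"
proof -
  have "(b = 0 \<and> (a, c) \<in># M) \<or> (b = 1 \<and> (c, a) \<in># M)"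
    using p by (auto simp: keyset_def intro: count_inI)
  then show "b \<le> 1" "a < mdim M" "b = 0 \<Longrightarrow> a \<le> c" "b = 1 \<Longrightarrow> c \<le> a"
    using fishburnD(1,2,3)[OF f] by auto
qed

lemma keyset_exists:
  assumes f: "fishburn M" and i: "i < mdim M" and b: "b \<le> 1"
  shows "\<exists>c m. (i, b, c, m) \<in> keyset M"
proof -
  consider "b = 0" | "b = 1" using b by linarith
  then show ?thesis
  proof cases
    case 1
    obtain j where "(i, j) \<in># M" using fishburnD(4)[OF f i] by blast
    then have "(i, 0, j, 0) \<in> keyset M" by (simp add: keyset_def)
    then show ?thesis using 1 by blast
  next
    case 2
    obtain j where "(j, i) \<in># M" using fishburnD(5)[OF f i] by blast
    then have "(i, 1, j, 0) \<in> keyset M" by (simp add: keyset_def)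
    then show ?thesis using 2 by blast
  qed
qed

text \<open>Point x receives the x-th smallest key of \<open>keyset M\<close> and is matched with
  the point carrying the flipped key. The main point is that the run number of x in this matching is
  the first component of its key.\<close>

lemma regular_involution_exists:
  assumes "M \<in> fishburns n"
  shows "\<exists>\<mu>. regular_involution (2 * n) \<mu> \<and> matrix (2 * n) \<mu> = M"
proof (cases "n = 0")
  case True
  then have "M = {#}" using assms by (simp add: fishburns_0)
  moreover have "regular_involution 0 \<mu>" for \<mu> by unfold_locales auto
  moreover have "matrix 0 \<mu> = {#}" for \<mu> by (simp add: matrix_def)
  ultimately show ?thesis using True by simp
next
  case False
  from assms have f: "fishburn M" and sz: "size M = n" by (auto simp: fishburns_def)
  define N where "N = 2 * n"
  define K where "K = keyset M"
  define \<kappa> where "\<kappa> = (\<lambda>x. sorted_list_of_set K ! (x - 1))"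
  have finK: "finite K" and cardK: "card K = N" using card_keyset[of M] sz by (auto simp: K_def N_def)
  have kless: "\<kappa> x < \<kappa> y" if "x \<in> {1..N}" "y \<in> {1..N}" "x < y" for x y
    unfolding \<kappa>_def using that cardK
    by (intro sorted_wrt_nth_less[OF strict_sorted_list_of_set]) auto
  then have kless_iff: "\<kappa> x < \<kappa> y \<longleftrightarrow> x < y" if "x \<in> {1..N}" "y \<in> {1..N}" for x y
    using that by (metis less_asym less_irrefl nat_neq_iff)
  have kinj: "\<kappa> x = \<kappa> y \<longleftrightarrow> x = y" if "x \<in> {1..N}" "y \<in> {1..N}" for x y
    using that kless by (metis less_irrefl nat_neq_iff)
  have kK: "\<kappa> x \<in> K" if "x \<in> {1..N}" for x
    using that nth_mem[of "x - 1" "sorted_list_of_set K"] finK cardK unfolding \<kappa>_def by auto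
  have ksurj: "\<exists>x\<in>{1..N}. \<kappa> x = p" if "p \<in> K" for p
  proof -
    have "p \<in> set (sorted_list_of_set K)" using that finK by simp
    then obtain i where "i < N" "sorted_list_of_set K ! i = p"
      using cardK by (auto simp: in_set_conv_nth)
    then show ?thesis by (intro bexI[of _ "Suc i"]) (auto simp: \<kappa>_def)
  qed
  define \<mu> where "\<mu> = (\<lambda>x. THE y. y \<in> {1..N} \<and> \<kappa> y = flip (\<kappa> x))"
  have mu: "\<mu> x \<in> {1..N}" "\<kappa> (\<mu> x) = flip (\<kappa> x)" if x: "x \<in> {1..N}" for x
  proof -
    have "flip (\<kappa> x) \<in> K" using flip_keyset(1) kK[OF x] by (simp add: K_def)
    then obtain y where "y \<in> {1..N}" "\<kappa> y = flip (\<kappa> x)" using ksurj by blast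
    then have "\<exists>!y. y \<in> {1..N} \<and> \<kappa> y = flip (\<kappa> x)" using kinj by metis
    from theI'[OF this] show "\<mu> x \<in> {1..N}" "\<kappa> (\<mu> x) = flip (\<kappa> x)" by (auto simp: \<mu>_def)
  qed
  have inv: "involution N \<mu>"
  proof
    fix x assume x: "x \<in> {1..N}"
    show "\<mu> x \<in> {1..N}" using mu x by blast
    show "\<mu> x \<noteq> x" using mu[OF x] flip_keyset(3) kK[OF x] by (metis K_def)
    have "\<kappa> (\<mu> (\<mu> x)) = \<kappa> x" using mu(2)[OF mu(1)[OF x]] mu(2)[OF x] flip_keyset(2) kK[OF x] by (simp add: K_def)
    then show "\<mu> (\<mu> x) = x" using kinj mu x by blast
  qed
  \<comment> \<open>A key and its flip are ordered by the bounds a \<le> c for opener keys and c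
    \<le> a for closer keys; if a = c, the type decides.\<close>
  have opener: "x < \<mu> x \<longleftrightarrow> fst (snd (\<kappa> x)) = 0" if x: "x \<in> {1..N}" for x
  proof -
    obtain a b c m where p: "\<kappa> x = (a, b, c, m)" by (cases "\<kappa> x") auto
    note B = keyset_bounds[OF f kK[OF x, unfolded p K_def]]
    have "x < \<mu> x \<longleftrightarrow> \<kappa> x < flip (\<kappa> x)" using kless_iff[OF x mu(1)[OF x]] mu(2)[OF x] by simp
    also have "\<dots> \<longleftrightarrow> b = 0" using B unfolding p flip_def by (cases "b = 0") auto
    finally show ?thesis by (simp add: p)
  qed
  have closer: "\<mu> x < x \<longleftrightarrow> fst (snd (\<kappa> x)) = 1" if x: "x \<in> {1..N}" for x
  proof -
    obtain a b c m where p: "\<kappa> x = (a, b, c, m)" by (cases "\<kappa> x") auto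
    note B = keyset_bounds[OF f kK[OF x, unfolded p K_def]]
    then show ?thesis using opener[OF x] involution.mu_ne[OF inv x] p by auto
  qed
  \<comment> \<open>Every index below \<open>mdim M\<close> occurs in an opener key and in a closer
    key. If the first component rises between neighbouring points, the closer key of the old index
    and the opener keys of the new index and of the successor of the old one leave room only for a
    rise by 1 from a closer to an opener.\<close>
  have next_key: "(fst (\<kappa> (Suc x)) = fst (\<kappa> x) \<and> \<not> descent \<mu> x) \<or> (fst (\<kappa> (Suc x)) = Suc (fst (\<kappa> x)) \<and> descent \<mu> x)"
    if x: "x \<ge> 1" "Suc x \<le> N" for x
  proof -
    have xN: "x \<in> {1..N}" "Suc x \<in> {1..N}" using x by auto
    obtain a b c m where p: "\<kappa> x = (a, b, c, m)" by (cases "\<kappa> x") auto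
    obtain a' b' c' m' where q: "\<kappa> (Suc x) = (a', b', c', m')" by (cases "\<kappa> (Suc x)") auto
    note B = keyset_bounds[OF f kK[OF xN(1), unfolded p K_def]]
    note B' = keyset_bounds[OF f kK[OF xN(2), unfolded q K_def]]
    have lt: "(a, b, c, m) < (a', b', c', m')" using kless[OF xN] p q by simp
    have between: "r \<le> (a, b, c, m) \<or> (a', b', c', m') \<le> r" if r: "r \<in> K" for r
    proof -
      obtain z where z: "z \<in> {1..N}" "\<kappa> z = r" using ksurj[OF r] by blast
      consider "z < x" | "z = x" | "z = Suc x" | "z > Suc x" by linarith
      then show ?thesis
        by cases (use kless[OF z(1) xN(1)] kless[OF xN(2) z(1)] z p q in auto)
    qed
    have desc: "descent \<mu> x \<longleftrightarrow> b = 1 \<and> b' = 0"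
      using opener[OF xN(2)] closer[OF xN(1)] p q by (simp add: descent_def)
    show ?thesis
    proof (cases "a = a'")
      case True
      then show ?thesis using lt by (auto simp: p q desc)
    next
      case False
      then have aa': "a < a'" using lt by auto
      obtain c1 m1 where "(a, 1, c1, m1) \<in> K" using keyset_exists[OF f B(2), of 1] by (auto simp: K_def)
      from between[OF this] have b: "b = 1" using aa' B(1) by auto
      obtain c2 m2 where "(a', 0, c2, m2) \<in> K" using keyset_exists[OF f B'(2), of 0] by (auto simp: K_def)
      from between[OF this] have b': "b' = 0" using aa' by auto
      have "Suc a < mdim M" using aa' B'(2) by linarith
      then obtain c3 m3 where "(Suc a, 0, c3, m3) \<in> K" using keyset_exists[OF f, of "Suc a" 0] by (auto simp: K_def)
      from between[OF this] have "a' = Suc a" using aa' by auto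
      then show ?thesis using b b' by (simp add: p q desc)
    qed
  qed
  have run: "run \<mu> x = fst (\<kappa> x)" if "x \<in> {1..N}" for x
  proof -
    have "1 \<le> x" "x \<le> N" using that by auto
    then show ?thesis
    proof (induction x rule: dec_induct)
      case base
      then have 1: "1 \<in> {1..N}" by simp
      have "M \<noteq> {#}" using False sz by auto
      then have "0 < mdim M" by (metis gr0I mdim_eq_0_iff)
      then obtain c m where "(0, 0, c, m) \<in> K" using keyset_exists[OF f, of 0 0] by (auto simp: K_def)
      then obtain z where z: "z \<in> {1..N}" "\<kappa> z = (0, 0, c, m)" using ksurj by blast
      then have "\<kappa> 1 \<le> (0, 0, c, m)" using kless[OF 1 z(1)] by (cases "z = 1") (auto simp: less_imp_le)
      then show ?case by (cases "\<kappa> 1") auto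
    next
      case (step x)
      then show ?case using next_key[of x] run_Suc[of x \<mu>] by auto
    qed
  qed
  have reg: "regular_involution N \<mu>"
  proof (intro regular_involution.intro inv regular_involution_axioms.intro)
    fix x assume x: "1 \<le> x" "Suc x \<le> N"
    then have xN: "x \<in> {1..N}" "Suc x \<in> {1..N}" by auto
    obtain a b c m where p: "\<kappa> x = (a, b, c, m)" by (cases "\<kappa> x") auto
    obtain a' b' c' m' where q: "\<kappa> (Suc x) = (a', b', c', m')" by (cases "\<kappa> (Suc x)") auto
    have lt: "(a, b, c, m) < (a', b', c', m')" using kless[OF xN] p q by simp
    \<comment> \<open>With equal run and type, the order is that of the mate's run and then of the
      counter, which \<open>flip\<close> keeps.\<close>
    have goal: "\<mu> x < \<mu> (Suc x)" if "b = b'" "\<not> descent \<mu> x"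
    proof -
      have "a = a'" using next_key[OF x] that p q by auto
      then have "flip (\<kappa> x) < flip (\<kappa> (Suc x))" using lt that by (auto simp: p q flip_def)
      then show ?thesis using kless_iff[OF mu(1)[OF xN(1)] mu(1)[OF xN(2)]] mu(2) xN by simp
    qed
    show "\<mu> x < \<mu> (Suc x)" if "x < \<mu> x" "Suc x < \<mu> (Suc x)"
      using goal that opener[OF xN(1)] opener[OF xN(2)] p q by (auto simp: descent_def)
    show "\<mu> x < \<mu> (Suc x)" if "\<mu> x < x" "\<mu> (Suc x) < Suc x"
      using goal that closer[OF xN(1)] closer[OF xN(2)] p q by (auto simp: descent_def)
  qed
  have "matrix N \<mu> = M"
  proof (rule multiset_eqI)
    fix v :: "nat \<times> nat"
    obtain i j where v: "v = (i, j)" by (cases v)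
    define S where "S = {x \<in> {1..N}. x < \<mu> x \<and> (run \<mu> x, run \<mu> (\<mu> x)) = v}"
    have S: "x \<in> S \<longleftrightarrow> x \<in> {1..N} \<and> (\<exists>m. \<kappa> x = (i, 0, j, m))" for x
    proof (cases "x \<in> {1..N}")
      case True
      obtain a b c m where p: "\<kappa> x = (a, b, c, m)" by (cases "\<kappa> x") auto
      have "run \<mu> (\<mu> x) = c" using run[OF mu(1)[OF True]] mu(2)[OF True] by (simp add: p flip_def)
      then show ?thesis using True run[OF True] opener[OF True] by (auto simp: S_def v p)
    qed (auto simp: S_def)
    have "\<kappa> ` S = (\<lambda>m. (i, 0, j, m)) ` {..<count M (i, j)}"
    proof (intro equalityI subsetI)
      fix p assume "p \<in> \<kappa> ` S"
      then obtain x m where "x \<in> {1..N}" "p = \<kappa> x" "\<kappa> x = (i, 0, j, m)" using S by auto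
      then show "p \<in> (\<lambda>m. (i, 0, j, m)) ` {..<count M (i, j)}"
        using kK[of x] by (auto simp: K_def keyset_def)
    next
      fix p assume "p \<in> (\<lambda>m. (i, 0::nat, j, m)) ` {..<count M (i, j)}"
      then obtain m where p: "p = (i, 0, j, m)" "m < count M (i, j)" by auto
      then have "p \<in> K" by (auto simp: K_def keyset_def)
      then show "p \<in> \<kappa> ` S" using ksurj S p by (metis imageI)
    qed
    moreover have "inj_on \<kappa> S" using kinj S by (auto simp: inj_on_def)
    moreover have "inj_on (\<lambda>m. (i, 0::nat, j, m)) {..<count M (i, j)}" by (simp add: inj_on_def)
    ultimately have "card S = count M v" using card_image by (metis card_lessThan v)
    then show "count (matrix N \<mu>) v = count M v" by (simp add: count_matrix S_def)
  qed
  then show ?thesis using reg by (auto simp: N_def)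
qed

section \<open>Chord diagrams\<close>

definition mate :: "nat set set \<Rightarrow> nat \<Rightarrow> nat" where
  "mate D x = (THE y. y \<noteq> x \<and> {x, y} \<in> D)"

lemma diagram_arc:
  assumes "linearized_chord_diagram n D" "A \<in> D"
  obtains x y where "A = {x, y}" "x < y" "x \<in> {1..2 * n}" "y \<in> {1..2 * n}"
proof -
  have "card A = 2" "A \<subseteq> {1..2 * n}"
    using assms by (auto simp: linearized_chord_diagram_def dest: partition_onD1)
  then obtain x y where "A = {x, y}" "x \<noteq> y" by (auto simp: card_2_iff)
  then show ?thesis using that[of x y] that[of y x] \<open>A \<subseteq> _\<close> by (metis insert_commute insert_subset nat_neq_iff)
qed

lemma diagram_disjoint:
  assumes "linearized_chord_diagram n D" "A \<in> D" "B \<in> D" "x \<in> A" "x \<in> B"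
  shows "A = B"
  using assms unfolding linearized_chord_diagram_def by (meson disjnt_iff pairwiseD partition_onD2 disjointD disjoint_iff)

lemma mate:
  assumes "linearized_chord_diagram n D" "x \<in> {1..2 * n}"
  shows "{x, mate D x} \<in> D" "mate D x \<noteq> x" "mate D x \<in> {1..2 * n}"
proof -
  obtain A where A: "A \<in> D" "x \<in> A"
    using assms partition_onD1 unfolding linearized_chord_diagram_def by blast
  obtain a b where ab: "A = {a, b}" "a < b" "a \<in> {1..2 * n}" "b \<in> {1..2 * n}"
    using diagram_arc[OF assms(1) A(1)] .
  have "\<exists>y. y \<noteq> x \<and> {x, y} \<in> D" using A ab by (metis insertE insert_commute less_irrefl singletonD)
  moreover have "y = z" if "y \<noteq> x \<and> {x, y} \<in> D" "z \<noteq> x \<and> {x, z} \<in> D" for y z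
    using diagram_disjoint[OF assms(1), of "{x, y}" "{x, z}" x] that by (auto simp: doubleton_eq_iff)
  ultimately have "\<exists>!y. y \<noteq> x \<and> {x, y} \<in> D" by blast
  from theI'[OF this] show *: "{x, mate D x} \<in> D" "mate D x \<noteq> x" by (auto simp: mate_def)
  obtain c d where "{x, mate D x} = {c, d}" "c \<in> {1..2 * n}" "d \<in> {1..2 * n}"
    using diagram_arc[OF assms(1) *(1)] by metis
  then show "mate D x \<in> {1..2 * n}" by (auto simp: doubleton_eq_iff)
qed

lemma mate_unique:
  assumes "linearized_chord_diagram n D" "{x, y} \<in> D" "x \<noteq> y"
  shows "mate D x = y" "x \<in> {1..2 * n}"
proof -
  show x: "x \<in> {1..2 * n}" using diagram_arc[OF assms(1,2)] by (metis insert_iff singletonD)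
  show "mate D x = y"
    using diagram_disjoint[OF assms(1) assms(2) mate(1)[OF assms(1) x], of x] mate(2)[OF assms(1) x] assms(3)
    by (auto simp: doubleton_eq_iff)
qed

lemma involution_mate:
  assumes "linearized_chord_diagram n D"
  shows "involution (2 * n) (mate D)"
proof
  fix x assume x: "x \<in> {1..2 * n}"
  note M = mate[OF assms x]
  show "mate D x \<in> {1..2 * n}" "mate D x \<noteq> x" using M by auto
  show "mate D (mate D x) = x"
    using mate_unique(1)[OF assms, of "mate D x" x] M by (simp add: insert_commute)
qed

lemma diagram_eq_arcs:
  assumes "linearized_chord_diagram n D"
  shows "D = (\<lambda>x. {x, mate D x}) ` {1..2 * n}"
proof (intro equalityI subsetI)
  fix A assume A: "A \<in> D"
  obtain x y where xy: "A = {x, y}" "x < y" "x \<in> {1..2 * n}" using diagram_arc[OF assms A] .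
  then have "mate D x = y" using mate_unique(1)[OF assms, of x y] A by simp
  then show "A \<in> (\<lambda>x. {x, mate D x}) ` {1..2 * n}" using xy by blast
next
  fix A assume "A \<in> (\<lambda>x. {x, mate D x}) ` {1..2 * n}"
  then show "A \<in> D" using mate(1)[OF assms] by blast
qed

lemma card_diagram:
  assumes "linearized_chord_diagram n D"
  shows "card D = n"
proof -
  have U: "\<Union>D = {1..2 * n}"
    using assms partition_onD1[of "{1..2 * n}" D] by (simp add: linearized_chord_diagram_def)
  have "card (\<Union>D) = (\<Sum>A\<in>D. card A)"
    using assms unfolding linearized_chord_diagram_def
    by (intro card_Union_disjoint) (auto dest!: partition_onD2 intro: card_ge_0_finite)
  also have "\<dots> = 2 * card D" using assms by (simp add: linearized_chord_diagram_def)
  finally show ?thesis by (simp add: U)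
qed

lemma regular_diagram_iff:
  assumes "linearized_chord_diagram n D"
  shows "regular_diagram D \<longleftrightarrow> regular_involution (2 * n) (mate D)"
proof
  interpret involution "2 * n" "mate D" by (rule involution_mate[OF assms])
  assume reg: "regular_diagram D"
  show "regular_involution (2 * n) (mate D)"
  proof
    fix x assume x: "1 \<le> x" "Suc x \<le> 2 * n"
    then have xN: "x \<in> {1..2 * n}" "Suc x \<in> {1..2 * n}" by auto
    have arcs: "{x, mate D x} \<in> D" "{Suc x, mate D (Suc x)} \<in> D" using mate(1)[OF assms] xN by blast+
    have ne: "mate D x \<noteq> mate D (Suc x)" using mu_eq_iff[OF xN] by simp
    show "mate D x < mate D (Suc x)" if "x < mate D x" "Suc x < mate D (Suc x)"
    proof (rule ccontr)
      assume "\<not> ?thesis"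
      then have "mate D (Suc x) < mate D x" using ne by simp
      then have "\<exists>a b c d. a < b \<and> b < c \<and> c < d \<and> {a, d} \<in> D \<and> {b, c} \<in> D \<and> (b = a + 1 \<or> d = c + 1)"
        using that arcs
        by (intro exI[of _ x] exI[of _ "Suc x"] exI[of _ "mate D (Suc x)"] exI[of _ "mate D x"]) auto
      then show False using reg unfolding regular_diagram_def by blast
    qed
    show "mate D x < mate D (Suc x)" if "mate D x < x" "mate D (Suc x) < Suc x"
    proof (rule ccontr)
      assume "\<not> ?thesis"
      then have "mate D (Suc x) < mate D x" using ne by simp
      then have "\<exists>a b c d. a < b \<and> b < c \<and> c < d \<and> {a, d} \<in> D \<and> {b, c} \<in> D \<and> (b = a + 1 \<or> d = c + 1)"
        using that arcs
        by (intro exI[of _ "mate D (Suc x)"] exI[of _ "mate D x"] exI[of _ x] exI[of _ "Suc x"])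
          (auto simp: insert_commute)
      then show False using reg unfolding regular_diagram_def by blast
    qed
  qed
next
  assume "regular_involution (2 * n) (mate D)"
  then interpret regular_involution "2 * n" "mate D" .
  show "regular_diagram D"
    unfolding regular_diagram_def
  proof (intro notI, elim exE conjE)
    fix a b c d assume o: "a < b" "b < c" "c < d" and D: "{a, d} \<in> D" "{b, c} \<in> D"
      and adj: "b = a + 1 \<or> d = c + 1"
    have D': "{d, a} \<in> D" "{c, b} \<in> D" using D by (simp_all add: insert_commute)
    have m: "mate D a = d" "mate D b = c" "mate D c = b" "mate D d = a"
      using mate_unique(1)[OF assms D(1)] mate_unique(1)[OF assms D(2)] mate_unique(1)[OF assms D'(1)] mate_unique(1)[OF assms D'(2)] o
      by auto
    have r: "1 \<le> a" "d \<le> 2 * n"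
      using mate_unique(2)[OF assms D(1)] mate_unique(2)[OF assms D'(1)] o by auto
    from adj show False
    proof
      assume "b = a + 1"
      then show False using reg_openers[of a] m o r by auto
    next
      assume "d = c + 1"
      then show False using reg_closers[of c] m o r by auto
    qed
  qed
qed

lemma diagram_of_involution:
  fixes n :: nat and \<mu> :: "nat \<Rightarrow> nat"
  defines "D \<equiv> (\<lambda>x. {x, \<mu> x}) ` {1..2 * n}"
  assumes "involution (2 * n) \<mu>"
  shows "linearized_chord_diagram n D" "x \<in> {1..2 * n} \<Longrightarrow> mate D x = \<mu> x"
proof -
  interpret involution "2 * n" \<mu> by fact
  have arc: "{x, \<mu> x} = {y, \<mu> y}" if "x \<in> {1..2 * n}" "y \<in> {1..2 * n}" "z \<in> {x, \<mu> x}" "z \<in> {y, \<mu> y}" for x y z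
    using that mu_eq_iff[OF that(1,2)] mu_mu by (auto simp: insert_commute)
  show lcd: "linearized_chord_diagram n D"
    unfolding linearized_chord_diagram_def
  proof (intro conjI partition_onI)
    show "\<Union>D = {1..2 * n}" using mu_in by (auto simp: D_def)
    show "disjnt p q" if pq: "p \<in> D" "q \<in> D" "p \<noteq> q" for p q
    proof -
      obtain x y where "x \<in> {1..2 * n}" "p = {x, \<mu> x}" "y \<in> {1..2 * n}" "q = {y, \<mu> y}"
        using pq unfolding D_def by blast
      then show ?thesis using arc[of x y] pq(3) unfolding disjnt_iff by blast
    qed
    show "{} \<notin> D" by (auto simp: D_def)
    show "\<forall>A\<in>D. card A = 2" using mu_ne by (force simp: D_def card_2_iff)
  qed
  show "mate D x = \<mu> x" if "x \<in> {1..2 * n}"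
    using mate_unique(1)[OF lcd, of x "\<mu> x"] mu_ne[OF that] that by (force simp: D_def)
qed

definition regular_diagrams :: "nat \<Rightarrow> nat set set set" where
  "regular_diagrams n = {D. linearized_chord_diagram n D \<and> regular_diagram D}"

definition diagram_matrix :: "nat \<Rightarrow> nat set set \<Rightarrow> (nat \<times> nat) multiset" where
  "diagram_matrix n D = matrix (2 * n) (mate D)"

lemma regular_diagramsD:
  assumes "D \<in> regular_diagrams n"
  shows "linearized_chord_diagram n D" "regular_involution (2 * n) (mate D)"
  using assms regular_diagram_iff by (auto simp: regular_diagrams_def)

lemma bij_betw_diagram_matrix: "bij_betw (diagram_matrix n) (regular_diagrams n) (fishburns n)"
proof (rule bij_betw_imageI)
  show "inj_on (diagram_matrix n) (regular_diagrams n)"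
  proof (rule inj_onI)
    fix D D' assume D: "D \<in> regular_diagrams n" and D': "D' \<in> regular_diagrams n"
      and eq: "diagram_matrix n D = diagram_matrix n D'"
    have "mate D x = mate D' x" if "x \<in> {1..2 * n}" for x
      using regular_involution_unique[OF regular_diagramsD(2)[OF D] regular_diagramsD(2)[OF D'] _ that] eq
      by (simp add: diagram_matrix_def)
    then show "D = D'"
      using diagram_eq_arcs[OF regular_diagramsD(1)[OF D]] diagram_eq_arcs[OF regular_diagramsD(1)[OF D']]
      by (metis (no_types, lifting) image_cong)
  qed
  show "diagram_matrix n ` regular_diagrams n = fishburns n"
  proof (intro equalityI subsetI)
    fix M assume "M \<in> diagram_matrix n ` regular_diagrams n"
    then obtain D where D: "D \<in> regular_diagrams n" and M: "M = matrix (2 * n) (mate D)"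
      by (auto simp: diagram_matrix_def)
    interpret regular_involution "2 * n" "mate D" by (rule regular_diagramsD[OF D])
    have "size M = n" using size_matrix by (simp add: M)
    moreover have "fishburn M"
    proof (cases "n = 0")
      case True
      then show ?thesis using fishburns_0 \<open>size M = n\<close> by (auto simp: fishburns_def)
    next
      case False
      then show ?thesis unfolding M by (intro fishburn_matrix) simp
    qed
    ultimately show "M \<in> fishburns n" by (simp add: fishburns_def)
  next
    fix M assume "M \<in> fishburns n"
    then obtain \<mu> where \<mu>: "regular_involution (2 * n) \<mu>" "matrix (2 * n) \<mu> = M"
      using regular_involution_exists by blast
    interpret \<mu>: regular_involution "2 * n" \<mu> by fact
    define D where "D = (\<lambda>x. {x, \<mu> x}) ` {1..2 * n}"
    note D = diagram_of_involution[OF \<mu>.involution_axioms, folded D_def]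
    have "regular_involution (2 * n) (mate D)"
    proof (intro regular_involution.intro regular_involution_axioms.intro involution_mate[OF D(1)])
      fix x assume "1 \<le> x" "Suc x \<le> 2 * n"
      then have "mate D x = \<mu> x" "mate D (Suc x) = \<mu> (Suc x)" using D(2) by auto
      then show "x < mate D x \<Longrightarrow> Suc x < mate D (Suc x) \<Longrightarrow> mate D x < mate D (Suc x)"
          "mate D x < x \<Longrightarrow> mate D (Suc x) < Suc x \<Longrightarrow> mate D x < mate D (Suc x)"
        using \<mu>.reg_openers[of x] \<mu>.reg_closers[of x] \<open>1 \<le> x\<close> \<open>Suc x \<le> 2 * n\<close> by auto
    qed
    then have "D \<in> regular_diagrams n" using D(1) regular_diagram_iff by (simp add: regular_diagrams_def)
    moreover have "diagram_matrix n D = M"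
      unfolding diagram_matrix_def \<mu>(2)[symmetric]
      by (rule \<mu>.matrix_cong[symmetric]) (use D(2) in simp)
    ultimately show "M \<in> diagram_matrix n ` regular_diagrams n" by blast
  qed
qed

lemma num_regular_eq: "num_regular n = card (fishburns n)"
  using bij_betw_same_card[OF bij_betw_diagram_matrix[of n]] by (simp add: num_regular_def regular_diagrams_def)

section \<open>Connectedness in terms of crossings\<close>

definition crossings :: "nat set set \<Rightarrow> (nat set \<times> nat set) set" where
  "crossings D = {(A, B). A \<in> D \<and> B \<in> D \<and> crossing A B}"

lemma crossing_sym: "crossing A B \<Longrightarrow> crossing B A"
  unfolding crossing_def by metis

lemma sym_crossings: "sym (crossings D)"
  by (auto simp: crossings_def intro!: symI crossing_sym)

lemma crossing_iff:
  assumes "a < b" "c < d"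
  shows "crossing {a, b} {c, d} \<longleftrightarrow> a < c \<and> c < b \<and> b < d \<or> c < a \<and> a < d \<and> d < b"
proof
  assume "crossing {a, b} {c, d}"
  then obtain a' b' c' d' where *: "{a, b} = {a', b'}" "{c, d} = {c', d'}" "a' < b'" "c' < d'"
      "a' < c' \<and> c' < b' \<and> b' < d' \<or> c' < a' \<and> a' < d' \<and> d' < b'"
    unfolding crossing_def by blast
  then have "a = a'" "b = b'" "c = c'" "d = d'" using assms by (auto simp: doubleton_eq_iff)
  with * show "a < c \<and> c < b \<and> b < d \<or> c < a \<and> a < d \<and> d < b" by blast
next
  assume "a < c \<and> c < b \<and> b < d \<or> c < a \<and> a < d \<and> d < b"
  then show "crossing {a, b} {c, d}" unfolding crossing_def using assms by blast
qed

text \<open>Crossing is symmetric, so the symmetric closure in the library notion adds nothing and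
  mutual reachability along crossings remains.\<close>

lemma connected_diagram_iff:
  "connected_diagram D \<longleftrightarrow> D \<noteq> {} \<and> (\<forall>A\<in>D. \<forall>B\<in>D. (A, B) \<in> rtrancl_on D (crossings D))"
proof -
  have "(\<Union>e\<in>crossings D. {(fst e, snd e), (snd e, fst e)}) = crossings D"
  proof (intro equalityI subsetI)
    fix e assume "e \<in> (\<Union>e\<in>crossings D. {(fst e, snd e), (snd e, fst e)})"
    then show "e \<in> crossings D" using symD[OF sym_crossings[of D]] by auto
  qed force
  then show ?thesis
    by (simp add: connected_diagram_def connected_def strongly_connected_def reachable_def
        mk_symmetric_def intersection_graph_def with_proj_simps crossings_def[symmetric])
qed

lemma connected_diagramI:
  assumes "A \<in> D" "\<And>B. B \<in> D \<Longrightarrow> (A, B) \<in> rtrancl_on D (crossings D)"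
  shows "connected_diagram D"
proof -
  have "(B, A) \<in> rtrancl_on D (crossings D)" if "B \<in> D" for B
    using symD[OF rtrancl_on_sym[OF sym_crossings] assms(2)[OF that]] .
  then have "(B, C) \<in> rtrancl_on D (crossings D)" if "B \<in> D" "C \<in> D" for B C
    using rtrancl_on_trans[of B A D "crossings D" C] assms(2) that by blast
  then show ?thesis unfolding connected_diagram_iff using assms(1) by blast
qed

text \<open>A point between the ends of the arc of a short index i would lie in run i and belong to
  a second arc touching i. So the ends are neighbours and nothing crosses the arc, while n \<ge> 2
  provides another arc to be reached.\<close>

lemma connected_imp_no_shorts:
  assumes D: "D \<in> regular_diagrams n" and con: "connected_diagram D" and n: "n \<ge> 2"
  shows "shorts (diagram_matrix n D) = {}"
proof (rule ccontr)
  assume "\<not> ?thesis"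
  then obtain i where i: "i \<in> shorts (diagram_matrix n D)" by blast
  note lcd = regular_diagramsD(1)[OF D]
  interpret regular_involution "2 * n" "mate D" by (rule regular_diagramsD[OF D])
  let ?r = "run (mate D)"
  define S where "S = {x \<in> {1..2 * n}. x < mate D x \<and> (?r x = i \<or> ?r (mate D x) = i)}"
  have "filter_mset (touching i) (diagram_matrix n D) =
      image_mset (\<lambda>x. (?r x, ?r (mate D x))) (mset_set S)"
    by (auto simp: diagram_matrix_def matrix_def filter_mset_image_mset touching_def S_def filter_mset_mset_set
        intro!: arg_cong[where f = "\<lambda>S. image_mset _ (mset_set S)"])
  then have "image_mset (\<lambda>x. (?r x, ?r (mate D x))) (mset_set S) = {#(i, i)#}"
    using i by (simp add: shorts_def)
  then obtain x where x: "mset_set S = {#x#}" "?r x = i" "?r (mate D x) = i"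
    by (auto simp: image_mset_eq_single)
  have finS: "finite S" by (simp add: S_def)
  have Sx: "S = {x}" using x(1) finS by (metis finite_set_mset_mset_set set_mset_single)
  then have xS: "x \<in> {1..2 * n}" "x < mate D x" by (auto simp: S_def)
  have adj: "mate D x = Suc x"
  proof (rule ccontr)
    assume "mate D x \<noteq> Suc x"
    then have z: "Suc x \<in> {1..2 * n}" "x < Suc x" "Suc x < mate D x" using xS mu_in[OF xS(1)] by auto
    then have rz: "?r (Suc x) = i" using run_mono[of x "Suc x" "mate D"] run_mono[of "Suc x" "mate D x" "mate D"] x by simp
    have "Suc x \<in> S \<or> mate D (Suc x) \<in> S"
      using z rz mu_in[OF z(1)] mu_ne[OF z(1)] mu_mu[OF z(1)] by (auto simp: S_def)
    then have "mate D (Suc x) = x" using Sx by auto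
    then show False using z mu_mu[OF z(1)] by simp
  qed
  have AD: "{x, Suc x} \<in> D" using mate(1)[OF lcd xS(1)] adj by simp
  have "card D \<noteq> card {{x, Suc x}}" using card_diagram[OF lcd] n by simp
  then obtain B where B: "B \<in> D" "B \<noteq> {x, Suc x}" using AD by (metis empty_iff insert_iff subsetI subset_singletonD)
  have "({x, Suc x}, B) \<in> rtrancl_on D (crossings D)" using con AD B connected_diagram_iff by blast
  then have "\<exists>C. C \<in> D \<and> crossing {x, Suc x} C"
    using B(2) by (induction rule: rtrancl_on_induct) (auto simp: crossings_def)
  then obtain C where C: "C \<in> D" "crossing {x, Suc x} C" by blast
  obtain c d where "C = {c, d}" "c < d" using diagram_arc[OF lcd C(1)] .
  then show False using C(2) crossing_iff[of x "Suc x" c d] by auto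
qed

text \<open>
  Let \<open>K\<close> be the component of the arc at 1. An interval \<open>{p..q}\<close> between two neighbouring points of \<open>K\<close> is
  closed under taking mates. By regularity it is preceded by a closer and followed by an opener
  or by the end of the diagram, hence it consists of complete runs.
\<close>

lemma disconnected_imp_block:
  assumes D: "D \<in> regular_diagrams n" and n: "n \<ge> 1" and dis: "\<not> connected_diagram D"
  shows "\<exists>g l. 0 < l \<and> l < mdim (diagram_matrix n D) \<and> is_block g l (diagram_matrix n D)"
proof -
  note lcd = regular_diagramsD(1)[OF D]
  interpret regular_involution "2 * n" "mate D" by (rule regular_diagramsD[OF D])
  define \<mu> where "\<mu> = mate D"
  note mu_in = mu_in[folded \<mu>_def] and mu_ne = mu_ne[folded \<mu>_def] and mu_mu = mu_mu[folded \<mu>_def]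
    and reg_openers = reg_openers[folded \<mu>_def] and reg_closers = reg_closers[folded \<mu>_def]
  let ?N = "2 * n"
  have arcD: "{x, \<mu> x} \<in> D" if "x \<in> {1..?N}" for x using mate(1)[OF lcd that] by (simp add: \<mu>_def)
  have one: "1 \<in> {1..?N}" using n by simp
  define K where "K = {B. ({1, \<mu> 1}, B) \<in> rtrancl_on D (crossings D)}"
  have KD: "K \<subseteq> D" using in_rtrancl_on_in_F(2) by (fastforce simp: K_def)
  have K1: "{1, \<mu> 1} \<in> K" using arcD[OF one] by (simp add: K_def)
  have Kstep: "C \<in> K" if "B \<in> K" "C \<in> D" "crossing B C" for B C
    using that KD rtrancl_on_into_rtrancl_on[of "{1, \<mu> 1}" B D "crossings D" C] by (auto simp: K_def crossings_def)
  obtain E0 where E0: "E0 \<in> D" "E0 \<notin> K"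
    using dis connected_diagramI[OF arcD[OF one]] by (auto simp: K_def)
  have disj: "y \<notin> B" if "A \<in> D" "B \<in> D" "A \<noteq> B" "y \<in> A" for A B y
    using diagram_disjoint[OF lcd, of A B y] that by blast
  \<comment> \<open>An arc of K does not cross the arc at x, so it avoids
    \<open>{x..\<mu> x}\<close> or lies strictly inside. The arc at 1 is not inside, and a path of
    crossings cannot enter: any arc that crosses an inside arc has an end in the interval.\<close>
  have outside: "B \<inter> {x..\<mu> x} = {}" if B: "B \<in> K" and x: "x \<in> {1..?N}" "x < \<mu> x" "{x, \<mu> x} \<notin> K" for B x
  proof -
    have ED: "{x, \<mu> x} \<in> D" using arcD x by blast
    have cases: "C \<inter> {x..\<mu> x} = {} \<or> (C \<subseteq> {x<..<\<mu> x})" if C: "C \<in> K" for C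
    proof -
      have CD: "C \<in> D" and ne: "{x, \<mu> x} \<noteq> C" using C KD x(3) by auto
      obtain c d where cd: "C = {c, d}" "c < d" using diagram_arc[OF lcd CD] .
      have "\<not> crossing C {x, \<mu> x}" using Kstep[OF C ED] x(3) by blast
      then have "\<not> (c < x \<and> x < d \<and> d < \<mu> x \<or> x < c \<and> c < \<mu> x \<and> \<mu> x < d)"
        using crossing_iff[OF cd(2) x(2)] cd(1) by auto
      moreover have "x \<noteq> c" "x \<noteq> d" "\<mu> x \<noteq> c" "\<mu> x \<noteq> d"
        using disj[OF ED CD ne, of x] disj[OF ED CD ne, of "\<mu> x"] cd by auto
      ultimately show ?thesis using cd by auto
    qed
    have "({1, \<mu> 1}, B) \<in> rtrancl_on D (crossings D)" using B by (simp add: K_def)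
    then show ?thesis
    proof (induction rule: rtrancl_on_induct)
      case base
      show ?case using cases[OF K1] x by auto
    next
      case (step B C)
      have BK: "B \<in> K" using step.hyps(1) by (simp add: K_def)
      have cr: "crossing B C" using step.hyps by (auto simp: crossings_def)
      have CK: "C \<in> K" using Kstep[OF BK step.hyps(4) cr] .
      obtain a b where ab: "B = {a, b}" "a < b" using diagram_arc[OF lcd step.hyps(3)] .
      obtain c d where cd: "C = {c, d}" "c < d" using diagram_arc[OF lcd step.hyps(4)] .
      from cases[OF CK] show ?case
      proof
        assume "C \<subseteq> {x<..<\<mu> x}"
        then have "a \<in> {x..\<mu> x} \<or> b \<in> {x..\<mu> x}"
          using cr[unfolded ab(1) cd(1) crossing_iff[OF ab(2) cd(2)]] cd by auto
        then show ?thesis using step.IH ab by auto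
      qed
    qed
  qed
  define U where "U = \<Union>K"
  have U1: "1 \<in> U" using K1 by (auto simp: U_def)
  have Uout: "z \<notin> U" if x: "x \<in> {1..?N}" "x \<notin> U" and z: "min x (\<mu> x) \<le> z" "z \<le> max x (\<mu> x)" for x z
  proof -
    have nK: "{x, \<mu> x} \<notin> K" using x(2) by (auto simp: U_def)
    have "B \<inter> {min x (\<mu> x)..max x (\<mu> x)} = {}" if "B \<in> K" for B
    proof (cases "x < \<mu> x")
      case True
      then show ?thesis using outside[OF that x(1) True nK] by simp
    next
      case False
      then have "\<mu> x < x" using mu_ne[OF x(1)] by simp
      then show ?thesis using outside[OF that mu_in[OF x(1)]] nK mu_mu[OF x(1)] by (simp add: insert_commute)
    qed
    then have "z \<notin> B" if "B \<in> K" for B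
      using that z by (metis IntI atLeastAtMost_iff empty_iff)
    then show ?thesis by (simp add: U_def)
  qed
  obtain e where e: "e \<in> {1..?N}" "e \<notin> U"
  proof -
    obtain x y where xy: "E0 = {x, y}" "x \<in> {1..?N}" using diagram_arc[OF lcd E0(1)] by metis
    have "x \<notin> U" unfolding U_def using disj[OF E0(1), of _ x] KD E0(2) xy by blast
    then show ?thesis using that xy by blast
  qed
  define p where "p = (LEAST z. z \<in> {1..?N} \<and> z \<notin> U)"
  have p: "p \<in> {1..?N}" "p \<notin> U"
    using LeastI[of "\<lambda>z. z \<in> {1..?N} \<and> z \<notin> U" e] e by (auto simp: p_def)
  have below_p: "z \<in> U" if "1 \<le> z" "z < p" for z
    using not_less_Least[of z "\<lambda>z. z \<in> {1..?N} \<and> z \<notin> U"] that p by (auto simp: p_def)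
  have p1: "p > 1" using p U1 by (metis atLeastAtMost_iff le_neq_implies_less)
  \<comment> \<open>The next point covered by K after p, with 2 n + 1 as sentinel if there is
    none.\<close>
  define s where "s = (LEAST z. p < z \<and> (z \<in> U \<or> z = Suc ?N))"
  have s: "p < s" "s \<in> U \<or> s = Suc ?N"
    using LeastI[of "\<lambda>z. p < z \<and> (z \<in> U \<or> z = Suc ?N)" "Suc ?N"] p by (auto simp: s_def)
  have s_le: "s \<le> Suc ?N" unfolding s_def by (rule Least_le) (use p in auto)
  have between: "z \<notin> U" if "p \<le> z" "z < s" for z
    using not_less_Least[of z "\<lambda>z. p < z \<and> (z \<in> U \<or> z = Suc ?N)"] that p by (cases "z = p") (auto simp: s_def)
  define q where "q = s - 1"
  have q: "s = Suc q" "p \<le> q" "q \<le> ?N" using s s_le by (auto simp: q_def)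
  \<comment> \<open>An arc leaving the interval would meet K: all points below p are covered by K,
    and an arc going beyond q reaches or spans s, which then is not the sentinel.\<close>
  have closed: "\<mu> z \<in> {p..q}" if z: "z \<in> {p..q}" for z
  proof (rule ccontr)
    assume neg: "\<mu> z \<notin> {p..q}"
    have zN: "z \<in> {1..?N}" using z p q by auto
    have zU: "z \<notin> U" using between z q by auto
    have m: "\<mu> z \<in> {1..?N}" by (rule mu_in[OF zN])
    consider "\<mu> z < p" | "s \<le> \<mu> z" using neg q by fastforce
    then show False
    proof cases
      case 1
      then have "\<mu> z \<in> U" using below_p m by auto
      then show False using Uout[OF zN zU, of "\<mu> z"] by simp
    next
      case 2
      then have "s \<in> U" using s(2) m by auto
      then show False using Uout[OF zN zU, of s] 2 z q by simp
    qed
  qed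
  have closed_iff: "\<mu> z \<in> {p..q} \<longleftrightarrow> z \<in> {p..q}" if "z \<in> {1..?N}" for z
    using closed[of "\<mu> z"] unfolding mu_mu[OF that] by (intro iffI closed)
  have qN: "q \<in> {1..?N}" using q p by auto
  have p_op: "p < \<mu> p" using closed[of p] mu_ne[OF p(1)] q by auto
  have q_cl: "\<mu> q < q" using closed[of q] mu_ne[OF qN] q by auto
  \<comment> \<open>If p - 1 were an opener, regularity would put its mate below that of p, hence
    into the closed interval that p - 1 is not in.\<close>
  have desc_p: "descent \<mu> (p - 1)"
  proof -
    have pN: "p - 1 \<in> {1..?N}" and Sp: "Suc (p - 1) = p" using p p1 by auto
    have "\<not> p - 1 < \<mu> (p - 1)"
    proof
      assume o: "p - 1 < \<mu> (p - 1)"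
      then have "\<mu> (p - 1) < \<mu> p" using reg_openers[of "p - 1"] p_op Sp p pN by auto
      then have "\<mu> (p - 1) \<in> {p..q}" using o closed[of p] q by auto
      then show False using closed_iff[OF pN] p1 by auto
    qed
    then have "\<mu> (p - 1) < p - 1" using mu_ne[OF pN] by linarith
    then show ?thesis unfolding descent_def using p_op Sp by simp
  qed
  have desc_q: "descent \<mu> q" if "q < ?N"
  proof -
    have sN: "Suc q \<in> {1..?N}" using that by auto
    have "\<not> \<mu> (Suc q) < Suc q"
    proof
      assume c: "\<mu> (Suc q) < Suc q"
      then have "\<mu> q < \<mu> (Suc q)" using reg_closers[of q] q_cl qN sN by auto
      then have "\<mu> (Suc q) \<in> {p..q}" using c closed[of q] q by auto
      then show False using closed_iff[OF sN] by auto
    qed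
    then have "Suc q < \<mu> (Suc q)" using mu_ne[OF sN] by linarith
    then show ?thesis unfolding descent_def using q_cl by simp
  qed
  have run_p: "run \<mu> p = Suc (run \<mu> (p - 1))"
    using run_Suc[of "p - 1" \<mu>] desc_p p1 by simp
  \<comment> \<open>The runs of the interval are those numbered g to \<open>run \<mu> q\<close>. The
    descent at p - 1 gives g > 0, so the block is proper.\<close>
  define g where "g = run \<mu> p"
  define l where "l = Suc (run \<mu> q) - g"
  have gl: "g + l = Suc (run \<mu> q)" "0 < l" "0 < g"
    using run_mono[OF q(2), of \<mu>] run_p by (auto simp: g_def l_def)
  have mem: "z \<in> {p..q} \<longleftrightarrow> run \<mu> z \<in> {g..<g + l}" if z: "z \<in> {1..?N}" for z
  proof -
    have "run \<mu> z < g" if "z < p"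
    proof -
      have "run \<mu> z \<le> run \<mu> (p - 1)" by (rule run_mono) (use that in simp)
      then show ?thesis using run_p by (simp add: g_def)
    qed
    moreover have "g + l \<le> run \<mu> z" if "q < z"
    proof -
      have "run \<mu> (Suc q) \<le> run \<mu> z" by (rule run_mono) (use that in simp)
      moreover have "run \<mu> (Suc q) = Suc (run \<mu> q)" using run_Suc[of q \<mu>] desc_q that z qN by simp
      ultimately show ?thesis using gl by simp
    qed
    moreover have "run \<mu> z \<in> {g..<g + l}" if "z \<in> {p..q}"
      using run_mono[of p z \<mu>] run_mono[of z q \<mu>] that gl by (auto simp: g_def)
    ultimately show ?thesis by (metis atLeastAtMost_iff atLeastLessThan_iff not_le)
  qed
  have dim: "mdim (diagram_matrix n D) = Suc (run \<mu> ?N)"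
    unfolding diagram_matrix_def \<mu>_def by (rule fishburn_matrix(2)) (use n in simp)
  have "is_block g l (diagram_matrix n D)"
    unfolding is_block_def
  proof (intro conjI allI impI)
    show "g + l \<le> mdim (diagram_matrix n D)" using run_mono[OF q(3), of \<mu>] gl dim by simp
    fix i j assume "(i, j) \<in># diagram_matrix n D"
    then obtain x where x: "x \<in> {1..?N}" "run \<mu> x = i" "run \<mu> (\<mu> x) = j"
      unfolding diagram_matrix_def \<mu>_def by (rule in_matrixE)
    then show "i \<in> {g..<g + l} \<longleftrightarrow> j \<in> {g..<g + l}"
      using mem[OF x(1)] mem[OF mu_in[OF x(1)]] closed_iff[OF x(1)] by simp
  qed
  moreover have "l < mdim (diagram_matrix n D)" using run_mono[OF q(3), of \<mu>] gl dim by simp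
  ultimately show ?thesis using gl by blast
qed

section \<open>Counting connected diagrams and the limit\<close>

text \<open>Short-free matrices of disconnected diagrams are decomposable. Together with
  \<open>num_connected_regular_le\<close> this determines the number of connected diagrams up to the
  convolution sum.\<close>

lemma card_shorts_free_le:
  assumes "n \<ge> 1"
  shows "card {M \<in> fishburns n. shorts M = {}} \<le> num_connected_regular n + card (decomposable n)"
proof -
  define S where "S = {D \<in> regular_diagrams n. connected_diagram D}"
  have "{M \<in> fishburns n. shorts M = {}} \<subseteq> diagram_matrix n ` S \<union> decomposable n"
  proof
    fix M assume M: "M \<in> {M \<in> fishburns n. shorts M = {}}"
    then obtain D where D: "D \<in> regular_diagrams n" "M = diagram_matrix n D"
      using bij_betw_imp_surj_on[OF bij_betw_diagram_matrix, of n] by blast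
    show "M \<in> diagram_matrix n ` S \<union> decomposable n"
    proof (cases "connected_diagram D")
      case True
      then show ?thesis using D by (auto simp: S_def)
    next
      case False
      then show ?thesis using disconnected_imp_block[OF D(1) assms] D M by (auto simp: decomposable_def)
    qed
  qed
  moreover have fin: "finite S" "finite (decomposable n)"
    using finite_subset[OF _ finite_linearized_chord_diagrams[of n]] finite_subset[OF _ finite_fishburns[of n]]
    by (auto simp: S_def regular_diagrams_def decomposable_def)
  ultimately have "card {M \<in> fishburns n. shorts M = {}} \<le> card (diagram_matrix n ` S \<union> decomposable n)"
    by (intro card_mono) auto
  also have "\<dots> \<le> card (diagram_matrix n ` S) + card (decomposable n)" by (rule card_Un_le)
  also have "\<dots> \<le> card S + card (decomposable n)" using card_image_le[OF fin(1)] by simp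
  also have "card S = num_connected_regular n"
    by (simp add: S_def num_connected_regular_def regular_diagrams_def conj_assoc)
  finally show ?thesis .
qed

lemma num_connected_regular_le:
  assumes "n \<ge> 2"
  shows "num_connected_regular n \<le> card {M \<in> fishburns n. shorts M = {}}"
proof -
  define S where "S = {D \<in> regular_diagrams n. connected_diagram D}"
  have "diagram_matrix n ` S \<subseteq> {M \<in> fishburns n. shorts M = {}}"
    using connected_imp_no_shorts[OF _ _ assms] bij_betw_imp_surj_on[OF bij_betw_diagram_matrix, of n]
    by (auto simp: S_def)
  then have "card (diagram_matrix n ` S) \<le> card {M \<in> fishburns n. shorts M = {}}"
    by (intro card_mono) (auto simp: finite_fishburns)
  moreover have "card (diagram_matrix n ` S) = card S"
    using inj_on_subset[OF bij_betw_imp_inj_on[OF bij_betw_diagram_matrix]] by (intro card_image) (auto simp: S_def)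
  moreover have "card S = num_connected_regular n"
    by (simp add: S_def num_connected_regular_def regular_diagrams_def conj_assoc)
  ultimately show ?thesis by simp
qed

theorem theorem1p4:
  shows "\<exists>\<epsilon> :: nat \<Rightarrow> real. \<epsilon> \<in> O(\<lambda>n. 1 / real n) \<and>
    (\<forall>n. real (num_connected_regular n) / real (num_regular n) = exp (-1) * (1 + \<epsilon> n))"
proof -
  define f where "f = (\<lambda>n. real (card (fishburns n)))"
  define g where "g = (\<lambda>n. real (num_connected_regular n))"
  define h where "h = (\<lambda>n. real (card {M \<in> fishburns n. shorts M = {}}))"
  \<comment> \<open>Solved from the required identity, which thus holds for every n, as f is
    positive; only the size of \<epsilon> remains to be bounded.\<close>
  define \<epsilon> where "\<epsilon> = (\<lambda>n. exp 1 * (g n / f n) - 1)"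
  have fpos: "f n > 0" for n using card_fishburns_pos by (simp add: f_def)
  obtain C where C: "C > 0" and conv: "\<And>n. n \<ge> 4 \<Longrightarrow> real (\<Sum>s=2..n-2. card (fishburns s) * card (fishburns (n + 1 - s))) \<le> C * f n / real n"
    using card_fishburns_convolution unfolding f_def by metis
  \<comment> \<open>128 = 16 * 8 comes from \<open>shorts_free_ratio\<close> and
    \<open>card_fishburns_pred\<close>, and C from the decomposable matrices, where the convolution
    bound assumes n \<ge> 4.\<close>
  have bound: "\<bar>\<epsilon> n\<bar> \<le> (128 + exp 1 * C) * (1 / real n)" if n: "n \<ge> 4" for n
  proof -
    have "h n - g n \<le> C * f n / real n"
    proof -
      have "real (card (decomposable n)) \<le> C * f n / real n"
        using of_nat_mono[OF card_decomposable[of n], where 'a = real] conv[OF n] by linarith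
      moreover have "h n \<le> g n + real (card (decomposable n))"
        using of_nat_mono[OF card_shorts_free_le[of n], where 'a = real] n by (simp add: h_def g_def)
      ultimately show ?thesis by linarith
    qed
    then have "(h n - g n) / f n \<le> C / real n"
      using fpos[of n] by (simp add: divide_le_eq mult.commute)
    then have "exp 1 * ((h n - g n) / f n) \<le> exp 1 * (C / real n)" by (intro mult_left_mono) auto
    moreover have "0 \<le> exp 1 * ((h n - g n) / f n)"
      using num_connected_regular_le[of n] n fpos[of n] by (simp add: h_def g_def)
    moreover have "\<bar>exp 1 * (h n / f n) - 1\<bar> \<le> 128 / real n"
    proof -
      have n2: "n = (n - 2) + 2" "Suc (n - 2) = n - 1" using n by auto
      have "\<bar>exp 1 * (h n / f n) - 1\<bar> \<le> 16 * f (n - 1) / f n"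
        using shorts_free_ratio[of "n - 2"] n2 by (simp add: h_def f_def)
      also have "\<dots> \<le> 16 * (8 * f n / real n) / f n"
        using card_fishburns_pred[of n] n fpos[of n]
        by (intro divide_right_mono mult_left_mono) (auto simp: f_def)
      also have "\<dots> = 128 / real n" using fpos[of n] by (simp add: field_simps)
      finally show ?thesis .
    qed
    moreover have "\<epsilon> n = (exp 1 * (h n / f n) - 1) - exp 1 * ((h n - g n) / f n)"
      by (simp add: \<epsilon>_def diff_divide_distrib right_diff_distrib)
    ultimately have "\<bar>\<epsilon> n\<bar> \<le> 128 / real n + exp 1 * (C / real n)" by linarith
    then show ?thesis by (simp add: add_divide_distrib)
  qed
  have "\<epsilon> \<in> O(\<lambda>n. 1 / real n)"
    by (rule bigoI[where c = "128 + exp 1 * C"], rule eventually_sequentiallyI[of 4]) (use bound in simp)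
  moreover have "g n / real (num_regular n) = exp (-1) * (1 + \<epsilon> n)" for n
    by (simp add: \<epsilon>_def num_regular_eq f_def exp_minus field_simps)
  ultimately show ?thesis unfolding g_def by blast
qed

end
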